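(* Let $G$ be a finite simple hypergraph. Then $H^i(\mathcal L(G))$ is finite dimensional for every $i\ge0$.
   Context: A hypergraph $G$ consists of a set $V(G)$ of vertices and, for each $k>0$, a collection $E_k(G)$ of $k$-element subsets of $V(G)$ (the $k$-edges); $E(G)=\bigcup_kE_k(G)$. $G$ is finite if $V(G)$ is finite, and simple if any two distinct edges have nonempty symmetric difference. $H^\bullet(\mathcal L(G))$ denotes the cohomology of the Maurer–Cartan algebra $C^\bullet(\mathcal L(G))$ of the 2-step nilpotent $L_\infty$-algebra of $G$. Concretely, fixing an order on $V(G)$, $C^\bullet(\mathcal L(G))$ is the free graded-commutative real algebra (odd-degree generators anticommute and square to zero, even-degree generators are polynomial variables) on generators $x_i^*$ ($i\in V(G)$) of degree $1$ and $x_I^*$ ($I\in E(G)$) of degree $|I|-1$, with differential $d$ the degree-one derivation determined by $dx_i^*=0$ and $dx_I^*=x_{i_1}^*\cdots x_{i_k}^*$ for $I=\{i_1<\cdots<i_k\}$. $H^i(\mathcal L(G))$ is its cohomology in degree $i$. *)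

theory Defs
  imports
    "HOL-Library.Poly_Mapping"
    "HOL-Algebra.QuotRing"
    "Jordan_Normal_Form.VS_Connect"
begin

section \<open>Hypergraphs\<close>

text \<open>
  Edges carry names of their own: \<open>ends G e\<close> is the vertex set that underlies the edge \<open>e\<close>.
  So parallel edges are possible in general, and being simple is a genuine condition.
  A hypergraph whose edges are literally sets of vertices is the case \<open>ends G = id\<close>.
  The value \<open>k_edges G 0\<close> is never looked at.
\<close>

record ('v, 'e) hypergraph =
  verts :: "'v set"
  k_edges :: "nat \<Rightarrow> 'e set"
  ends :: "'e \<Rightarrow> 'v set"

definition edges :: "('v, 'e) hypergraph \<Rightarrow> 'e set" where
  "edges G = (\<Union>k\<in>{0<..}. k_edges G k)"

definition hypergraph :: "('v, 'e) hypergraph \<Rightarrow> bool" where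
  "hypergraph G \<longleftrightarrow> (\<forall>k>0. \<forall>e\<in>k_edges G k. ends G e \<subseteq> verts G \<and> card (ends G e) = k)"

definition finite_hypergraph :: "('v, 'e) hypergraph \<Rightarrow> bool" where
  "finite_hypergraph G \<longleftrightarrow> finite (verts G)"

definition simple_hypergraph :: "('v, 'e) hypergraph \<Rightarrow> bool" where
  "simple_hypergraph G \<longleftrightarrow>
     (\<forall>e\<in>edges G. \<forall>f\<in>edges G. e \<noteq> f \<longrightarrow> sym_diff (ends G e) (ends G f) \<noteq> {})"


section \<open>Free associative algebras\<close>

text \<open>
  Lists form the free monoid under concatenation; the convolution product of
  \<^theory>\<open>HOL-Library.Poly_Mapping\<close> then turns \<open>'g list \<Rightarrow>\<^sub>0 real\<close> into the free associative
  (tensor) algebra on \<open>'g\<close>.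
\<close>

instantiation list :: (type) monoid_add
begin

definition zero_list_def: "0 = []"

definition plus_list_def: "xs + ys = xs @ ys"

instance
  by standard (simp_all add: zero_list_def plus_list_def)

end

type_synonym 'g tensor = "'g list \<Rightarrow>\<^sub>0 real"

abbreviation scalar :: "real \<Rightarrow> 'g tensor" where
  "scalar c \<equiv> Poly_Mapping.single 0 c"

definition word :: "'g list \<Rightarrow> 'g tensor" where
  "word w = Poly_Mapping.single w 1"

definition linear_extension :: "('g list \<Rightarrow> 'g tensor) \<Rightarrow> 'g tensor \<Rightarrow> 'g tensor" where
  "linear_extension f a = (\<Sum>w\<in>Poly_Mapping.keys a. scalar (Poly_Mapping.lookup a w) * f w)"

definition koszul_sign :: "int \<Rightarrow> 'a::ring_1" where
  "koszul_sign n = (if even n then 1 else - 1)"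


section \<open>Quotients of modules\<close>

text \<open>
  The fields besides \<open>smult\<close> are those of \<^const>\<open>FactRing\<close>. If \<open>N\<close> is merely a submodule, then
  \<open>mult\<close> and \<open>one\<close> have no meaning. The scalar product takes full cosets, like
  \<^const>\<open>rcoset_mult\<close>, so that \<open>0\<close> times a coset is \<open>N\<close> and not just the zero element.
\<close>

definition quotient_module :: "('r, 'a) module \<Rightarrow> 'a set \<Rightarrow> ('r, 'a set) module" where
  "quotient_module M N =
     \<lparr>carrier = a_rcosets\<^bsub>M\<^esub> N, mult = rcoset_mult M N, one = N +>\<^bsub>M\<^esub> \<one>\<^bsub>M\<^esub>, zero = N, add = set_add M,
      smult = (\<lambda>c X. \<Union>x\<in>X. N +>\<^bsub>M\<^esub> (c \<odot>\<^bsub>M\<^esub> x))\<rparr>"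


section \<open>The Maurer--Cartan algebra\<close>

datatype ('v, 'e) generator = Vertex 'v | Edge 'e

definition generators :: "('v, 'e) hypergraph \<Rightarrow> ('v, 'e) generator set" where
  "generators G = Vertex ` verts G \<union> Edge ` edges G"

fun gen_degree :: "('v, 'e) hypergraph \<Rightarrow> ('v, 'e) generator \<Rightarrow> int" where
  "gen_degree G (Vertex i) = 1"
| "gen_degree G (Edge e) = int (card (ends G e)) - 1"

definition word_degree :: "('v, 'e) hypergraph \<Rightarrow> ('v, 'e) generator list \<Rightarrow> int" where
  "word_degree G w = (\<Sum>g\<leftarrow>w. gen_degree G g)"

definition tensor_algebra ::
  "('v, 'e) hypergraph \<Rightarrow> (real, ('v, 'e) generator tensor) module" where
  "tensor_algebra G =
     \<lparr>carrier = {a. Poly_Mapping.keys a \<subseteq> lists (generators G)},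
      mult = (*), one = 1, zero = 0, add = (+), smult = (\<lambda>c a. scalar c * a)\<rparr>"

definition tensor_component ::
  "('v, 'e) hypergraph \<Rightarrow> int \<Rightarrow> ('v, 'e) generator tensor set" where
  "tensor_component G n =
     {a \<in> carrier (tensor_algebra G). \<forall>w\<in>Poly_Mapping.keys a. word_degree G w = n}"

text \<open>
  For \<open>g = h\<close> of odd degree the relation reads \<open>2 g\<^sup>2 = 0\<close>, so that odd generators square to zero.
\<close>

definition graded_commutators ::
  "('v, 'e) hypergraph \<Rightarrow> ('v, 'e) generator tensor set" where
  "graded_commutators G =
     {word [g, h] - koszul_sign (gen_degree G g * gen_degree G h) * word [h, g] | g h.
        g \<in> generators G \<and> h \<in> generators G}"

definition commutator_ideal ::
  "('v, 'e) hypergraph \<Rightarrow> ('v, 'e) generator tensor set" where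
  "commutator_ideal G = genideal (tensor_algebra G) (graded_commutators G)"

definition MC_algebra ::
  "('v, 'e) hypergraph \<Rightarrow> (real, ('v, 'e) generator tensor set) module" where
  "MC_algebra G = quotient_module (tensor_algebra G) (commutator_ideal G)"

definition MC_component ::
  "('v, 'e) hypergraph \<Rightarrow> int \<Rightarrow> ('v, 'e) generator tensor set set" where
  "MC_component G n = (\<lambda>a. commutator_ideal G +>\<^bsub>tensor_algebra G\<^esub> a) ` tensor_component G n"

fun gen_diff ::
  "('v::linorder, 'e) hypergraph \<Rightarrow> ('v, 'e) generator \<Rightarrow> ('v, 'e) generator tensor" where
  "gen_diff G (Vertex i) = 0"
| "gen_diff G (Edge e) = word (map Vertex (sorted_list_of_set (ends G e)))"

fun word_diff ::
  "('v::linorder, 'e) hypergraph \<Rightarrow> ('v, 'e) generator list \<Rightarrow> ('v, 'e) generator tensor" where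
  "word_diff G [] = 0"
| "word_diff G (g # w) =
     gen_diff G g * word w + koszul_sign (gen_degree G g) * word [g] * word_diff G w"

definition tensor_diff ::
  "('v::linorder, 'e) hypergraph \<Rightarrow> ('v, 'e) generator tensor \<Rightarrow> ('v, 'e) generator tensor" where
  "tensor_diff G = linear_extension (word_diff G)"

definition MC_diff ::
  "('v::linorder, 'e) hypergraph \<Rightarrow> ('v, 'e) generator tensor set \<Rightarrow> ('v, 'e) generator tensor set" where
  "MC_diff G X = (\<Union>a\<in>X. commutator_ideal G +>\<^bsub>tensor_algebra G\<^esub> tensor_diff G a)"


section \<open>Cohomology\<close>

text \<open>
  The grading is by integers, so that coboundaries need no special case in degree \<open>0\<close>: generators have
  degree at least \<open>0\<close> (1-edges give generators of degree \<open>0\<close>), hence degree \<open>-1\<close> is zero.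
\<close>

definition cocycles ::
  "('v::linorder, 'e) hypergraph \<Rightarrow> int \<Rightarrow> ('v, 'e) generator tensor set set" where
  "cocycles G n = {X \<in> MC_component G n. MC_diff G X = \<zero>\<^bsub>MC_algebra G\<^esub>}"

definition coboundaries ::
  "('v::linorder, 'e) hypergraph \<Rightarrow> int \<Rightarrow> ('v, 'e) generator tensor set set" where
  "coboundaries G n = MC_diff G ` MC_component G (n - 1)"

definition cohomology ::
  "('v::linorder, 'e) hypergraph \<Rightarrow> int \<Rightarrow> (real, ('v, 'e) generator tensor set set) module" where
  "cohomology G n =
     quotient_module (MC_algebra G \<lparr>carrier := cocycles G n\<rparr>) (coboundaries G n)"


section \<open>Well-definedness\<close>

subsection \<open>Linear maps on the tensor algebra\<close>

lemma word_Nil: "word [] = 1"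
  by (simp add: word_def single_one flip: zero_list_def)

lemma word_append: "word (u @ v) = word u * word v"
  by (simp add: word_def mult_single plus_list_def)

lemma scalar_times_word: "scalar c * word w = Poly_Mapping.single w c"
  by (simp add: word_def mult_single)

lemma tensor_induct [case_names zero add monomial]:
  fixes a :: "'g tensor"
  assumes "P 0" and "\<And>a b. P a \<Longrightarrow> P b \<Longrightarrow> P (a + b)" and "\<And>c w. P (scalar c * word w)"
  shows "P a"
proof (induction a rule: update_induct)
  case const
  show ?case by (fact assms(1))
next
  case (update a w c)
  have "Poly_Mapping.update w c a = a + Poly_Mapping.single w c"
    using update(1)
    by (intro poly_mapping_eqI) (auto simp: lookup_update lookup_add lookup_single in_keys_iff when_def)
  then show ?case
    using assms(2)[OF update(3) assms(3)[of c w]] by (simp add: scalar_times_word)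
qed

lemma scalar_commute: "scalar c * a = a * (scalar c :: 'g tensor)"
proof (induction a rule: tensor_induct)
  case (monomial d w)
  show ?case by (simp add: word_def mult_single mult.commute)
qed (simp_all add: distrib_left distrib_right)

lemma scalar_mult_scalar_mult:
  "scalar c * x * (scalar d * y) = scalar (c * d) * (x * y :: 'g tensor)"
proof -
  have "scalar c * x * (scalar d * y) = scalar c * scalar d * (x * y)"
    by (metis mult.assoc scalar_commute)
  then show ?thesis
    by (simp add: mult_single)
qed

lemma linear_extension_zero [simp]: "linear_extension f 0 = 0"
  by (simp add: linear_extension_def)

lemma linear_extension_add:
  "linear_extension f (a + b) = linear_extension f a + linear_extension f b"
  unfolding linear_extension_def
  by (rule setsum_keys_plus_distrib) (simp_all add: single_add distrib_right)

lemma linear_extension_monomial: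
  "linear_extension f (scalar c * word w) = scalar c * f w"
  by (cases "c = 0") (simp_all add: scalar_times_word linear_extension_def)

lemma linear_extension_word [simp]: "linear_extension f (word w) = f w"
  using linear_extension_monomial[of f 1 w] by (simp add: single_one)

lemma linear_extension_scalar:
  "linear_extension f (scalar c * a) = scalar c * linear_extension f a"
proof (induction a rule: tensor_induct)
  case (monomial d w)
  show ?case
    by (simp add: mult_single linear_extension_monomial flip: mult.assoc)
qed (simp_all add: distrib_left linear_extension_add)

lemma linear_extension_uminus: "linear_extension f (- a) = - linear_extension f a"
  using linear_extension_add[of f "- a" a] by (simp add: eq_neg_iff_add_eq_0)

lemma linear_extension_diff:
  "linear_extension f (a - b) = linear_extension f a - linear_extension f b"
  using linear_extension_add[of f a "- b"] by (simp add: linear_extension_uminus)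

lemma koszul_sign_add: "koszul_sign (m + n) = koszul_sign m * koszul_sign n"
  by (auto simp: koszul_sign_def)

lemma koszul_sign_commute: "koszul_sign m * (a :: 'a::ring_1) = a * koszul_sign m"
  by (auto simp: koszul_sign_def)

lemma koszul_sign_self [simp]: "koszul_sign m * koszul_sign m = 1"
  by (auto simp: koszul_sign_def)

lemma koszul_sign_cases: "koszul_sign m = 1 \<or> koszul_sign m = -1"
  by (auto simp: koszul_sign_def)


subsection \<open>The derivation property\<close>

lemma tensor_diff_add: "tensor_diff G (a + b) = tensor_diff G a + tensor_diff G b"
  by (simp add: tensor_diff_def linear_extension_add)

lemma tensor_diff_zero [simp]: "tensor_diff G 0 = 0"
  by (simp add: tensor_diff_def)

lemma tensor_diff_uminus: "tensor_diff G (- a) = - tensor_diff G a"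
  by (simp add: tensor_diff_def linear_extension_uminus)

lemma tensor_diff_diff: "tensor_diff G (a - b) = tensor_diff G a - tensor_diff G b"
  by (simp add: tensor_diff_def linear_extension_diff)

lemma tensor_diff_scalar: "tensor_diff G (scalar c * a) = scalar c * tensor_diff G a"
  by (simp add: tensor_diff_def linear_extension_scalar)

lemma tensor_diff_word [simp]: "tensor_diff G (word w) = word_diff G w"
  by (simp add: tensor_diff_def)

lemma tensor_diff_one [simp]: "tensor_diff G 1 = 0"
  using tensor_diff_word[of G "[]"] by (simp add: word_Nil)

lemma tensor_diff_generator: "tensor_diff G (word [g]) = gen_diff G g"
  by (simp add: word_Nil)

lemma tensor_diff_koszul_sign: "tensor_diff G (koszul_sign m * a) = koszul_sign m * tensor_diff G a"
  by (simp add: koszul_sign_def tensor_diff_uminus)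

definition grade_involution ::
  "('v, 'e) hypergraph \<Rightarrow> ('v, 'e) generator tensor \<Rightarrow> ('v, 'e) generator tensor" where
  "grade_involution G = linear_extension (\<lambda>w. koszul_sign (word_degree G w) * word w)"

lemma grade_involution_add:
  "grade_involution G (a + b) = grade_involution G a + grade_involution G b"
  by (simp add: grade_involution_def linear_extension_add)

lemma grade_involution_diff:
  "grade_involution G (a - b) = grade_involution G a - grade_involution G b"
  by (simp add: grade_involution_def linear_extension_diff)

lemma grade_involution_uminus: "grade_involution G (- a) = - grade_involution G a"
  by (simp add: grade_involution_def linear_extension_uminus)

lemma grade_involution_zero [simp]: "grade_involution G 0 = 0"
  by (simp add: grade_involution_def)

lemma grade_involution_scalar:
  "grade_involution G (scalar c * a) = scalar c * grade_involution G a"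
  by (simp add: grade_involution_def linear_extension_scalar)

lemma grade_involution_word:
  "grade_involution G (word w) = koszul_sign (word_degree G w) * word w"
  by (simp add: grade_involution_def)

lemma grade_involution_koszul_sign:
  "grade_involution G (koszul_sign m * a) = koszul_sign m * grade_involution G a"
  by (simp add: koszul_sign_def grade_involution_uminus)

lemma word_degree_append: "word_degree G (u @ v) = word_degree G u + word_degree G v"
  by (simp add: word_degree_def)

lemma grade_involution_mult:
  "grade_involution G (a * b) = grade_involution G a * grade_involution G b"
proof (induction a rule: tensor_induct)
  case (monomial c u)
  show ?case
  proof (induction b rule: tensor_induct)
    case (monomial d v)
    have "grade_involution G (word u * word v) =
        grade_involution G (word u) * grade_involution G (word v)"
      by (auto simp: grade_involution_word word_degree_append koszul_sign_def simp flip: word_append)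
    then show ?case
      by (simp only: scalar_mult_scalar_mult grade_involution_scalar)
  qed (simp_all add: distrib_left grade_involution_add)
qed (simp_all add: distrib_right grade_involution_add)

lemma word_diff_append:
  "word_diff G (u @ v) =
     word_diff G u * word v + koszul_sign (word_degree G u) * word u * word_diff G v"
proof (induction u)
  case Nil
  show ?case by (simp add: word_degree_def koszul_sign_def word_Nil)
next
  case (Cons g u)
  have deg: "word_degree G (g # u) = gen_degree G g + word_degree G u"
    by (simp add: word_degree_def)
  have word: "word (g # u) = word [g] * word u" for u :: "('a, 'b) generator list"
    using word_append[of "[g]" u] by simp
  show ?case
    by (simp add: Cons.IH word[of u] word_append deg koszul_sign_def algebra_simps)
qed

lemma tensor_diff_mult_general:
  "tensor_diff G (a * b) = tensor_diff G a * b + grade_involution G a * tensor_diff G b"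
proof (induction a rule: tensor_induct)
  case (monomial c u)
  show ?case
  proof (induction b rule: tensor_induct)
    case (monomial d v)
    have "tensor_diff G (word u * word v) =
        tensor_diff G (word u) * word v + grade_involution G (word u) * tensor_diff G (word v)"
      by (simp add: word_diff_append grade_involution_word flip: word_append)
    then show ?case
      by (simp only: scalar_mult_scalar_mult grade_involution_scalar tensor_diff_scalar distrib_left)
  qed (simp_all add: distrib_left tensor_diff_add algebra_simps)
qed (simp_all add: distrib_right tensor_diff_add grade_involution_add algebra_simps)

lemma grade_involution_component:
  assumes "a \<in> tensor_component G n"
  shows "grade_involution G a = koszul_sign n * a"
proof -
  have "grade_involution G a =
      (\<Sum>w\<in>Poly_Mapping.keys a. koszul_sign n * (scalar (Poly_Mapping.lookup a w) * word w))"
    unfolding grade_involution_def linear_extension_def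
    using assms by (intro sum.cong) (auto simp: tensor_component_def koszul_sign_def)
  also have "\<dots> = koszul_sign n * linear_extension word a"
    by (simp add: linear_extension_def sum_distrib_left)
  also have "linear_extension word a = a"
    by (induction a rule: tensor_induct)
      (simp_all add: linear_extension_add linear_extension_monomial)
  finally show ?thesis .
qed

text \<open>The graded Leibniz rule in its usual form.\<close>

lemma tensor_diff_mult:
  assumes "a \<in> tensor_component G n"
  shows "tensor_diff G (a * b) = tensor_diff G a * b + koszul_sign n * a * tensor_diff G b"
  by (simp add: tensor_diff_mult_general grade_involution_component[OF assms])


lemma word_degree_gen_diff:
  assumes "w \<in> Poly_Mapping.keys (gen_diff G g)"
  shows "word_degree G w = gen_degree G g + 1"
  using assms
  by (cases g) (auto simp: word_def word_degree_def sum_list_triv comp_def split: if_splits)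

lemma grade_involution_gen_diff:
  "grade_involution G (gen_diff G g) = - (koszul_sign (gen_degree G g) * gen_diff G g)"
proof (cases g)
  case (Edge e)
  have "word_degree G (map Vertex (sorted_list_of_set (ends G e))) = gen_degree G g + 1"
    using word_degree_gen_diff[of _ G g] by (simp add: Edge word_def)
  then show ?thesis
    by (simp add: Edge grade_involution_word koszul_sign_def)
qed simp

lemma word_diff_vertices: "word_diff G (map Vertex vs) = 0"
  by (induction vs) simp_all

lemma tensor_diff_gen_diff: "tensor_diff G (gen_diff G g) = 0"
  by (cases g) (simp_all add: word_diff_vertices)

theorem tensor_diff_tensor_diff: "tensor_diff G (tensor_diff G a) = 0"
proof (induction a rule: tensor_induct)
  case (monomial c w)
  have "tensor_diff G (word_diff G w) = 0"
  proof (induction w)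
    case (Cons g w)
    have "tensor_diff G (word_diff G (g # w)) =
        grade_involution G (gen_diff G g) * word_diff G w +
        koszul_sign (gen_degree G g) * (gen_diff G g * word_diff G w)"
      unfolding word_diff.simps mult.assoc tensor_diff_add tensor_diff_koszul_sign
      unfolding tensor_diff_mult_general
      by (simp add: tensor_diff_gen_diff Cons.IH word_Nil)
    then show ?case
      by (simp add: grade_involution_gen_diff mult.assoc)
  qed simp
  then show ?case
    by (simp add: tensor_diff_scalar)
qed (simp_all add: tensor_diff_add)


subsection \<open>The tensor algebra as a ring and as a module\<close>

lemma tensor_algebra_simps [simp]:
  "mult (tensor_algebra G) = (*)" "one (tensor_algebra G) = 1" "zero (tensor_algebra G) = 0"
  "add (tensor_algebra G) = (+)" "smult (tensor_algebra G) = (\<lambda>c a. scalar c * a)"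
  by (simp_all add: tensor_algebra_def)

lemma tensor_carrier_iff:
  "a \<in> carrier (tensor_algebra G) \<longleftrightarrow> Poly_Mapping.keys a \<subseteq> lists (generators G)"
  by (simp add: tensor_algebra_def)

lemma tensor_carrier_zero [simp]: "0 \<in> carrier (tensor_algebra G)"
  by (simp add: tensor_carrier_iff)

lemma tensor_carrier_one [simp]: "1 \<in> carrier (tensor_algebra G)"
  by (simp add: tensor_carrier_iff zero_list_def)

lemma tensor_carrier_scalar [simp]: "scalar c \<in> carrier (tensor_algebra G)"
  by (simp add: tensor_carrier_iff zero_list_def)

lemma tensor_carrier_word: "word w \<in> carrier (tensor_algebra G) \<longleftrightarrow> w \<in> lists (generators G)"
  by (simp add: tensor_carrier_iff word_def)

lemma tensor_carrier_add:
  "a \<in> carrier (tensor_algebra G) \<Longrightarrow> b \<in> carrier (tensor_algebra G) \<Longrightarrow>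
     a + b \<in> carrier (tensor_algebra G)"
  using keys_add[of a b] by (auto simp: tensor_carrier_iff)

lemma tensor_carrier_uminus:
  "a \<in> carrier (tensor_algebra G) \<Longrightarrow> - a \<in> carrier (tensor_algebra G)"
  by (simp add: tensor_carrier_iff)

lemma tensor_carrier_diff:
  "a \<in> carrier (tensor_algebra G) \<Longrightarrow> b \<in> carrier (tensor_algebra G) \<Longrightarrow>
     a - b \<in> carrier (tensor_algebra G)"
  using tensor_carrier_add[of a G "- b"] by (simp add: tensor_carrier_uminus)

lemma tensor_carrier_mult:
  assumes "a \<in> carrier (tensor_algebra G)" "b \<in> carrier (tensor_algebra G)"
  shows "a * b \<in> carrier (tensor_algebra G)"
proof -
  have "Poly_Mapping.keys a \<subseteq> lists (generators G)" "Poly_Mapping.keys b \<subseteq> lists (generators G)"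
    using assms by (simp_all add: tensor_carrier_iff)
  then have "u + v \<in> lists (generators G)"
    if "u \<in> Poly_Mapping.keys a" "v \<in> Poly_Mapping.keys b" for u v
    using that by (auto simp: plus_list_def)
  then show ?thesis
    using keys_mult[of a b] unfolding tensor_carrier_iff by blast
qed

lemma tensor_carrier_koszul_sign:
  "a \<in> carrier (tensor_algebra G) \<Longrightarrow> koszul_sign n * a \<in> carrier (tensor_algebra G)"
  by (simp add: koszul_sign_def tensor_carrier_uminus)

lemma tensor_carrier_sum:
  "(\<And>x. x \<in> A \<Longrightarrow> f x \<in> carrier (tensor_algebra G)) \<Longrightarrow> sum f A \<in> carrier (tensor_algebra G)"
  by (induction A rule: infinite_finite_induct) (simp_all add: tensor_carrier_add)

lemmas tensor_carrier_intros = tensor_carrier_add tensor_carrier_uminus tensor_carrier_diff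
  tensor_carrier_mult tensor_carrier_koszul_sign

lemma tensor_abelian_group: "abelian_group (tensor_algebra G)"
proof (rule abelian_groupI)
  fix a assume "a \<in> carrier (tensor_algebra G)"
  then show "\<exists>b\<in>carrier (tensor_algebra G). b \<oplus>\<^bsub>tensor_algebra G\<^esub> a = \<zero>\<^bsub>tensor_algebra G\<^esub>"
    by (intro bexI[of _ "- a"]) (simp_all add: tensor_carrier_uminus)
qed (simp_all add: tensor_carrier_add add.assoc add.commute)

theorem tensor_ring: "ring (tensor_algebra G)"
  by (rule ringI)
    (simp_all add: tensor_abelian_group monoidI tensor_carrier_mult mult.assoc
      distrib_left distrib_right)

lemma class_ring_cring: "cring (class_ring :: real ring)"
  using class_field.field_axioms unfolding field_def domain_def by blast

theorem tensor_module: "module class_ring (tensor_algebra G)"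
  by (rule moduleI)
    (simp_all add: tensor_abelian_group class_ring_cring tensor_carrier_mult
      single_add distrib_left distrib_right mult_single flip: mult.assoc)

lemma tensor_a_inv:
  assumes "a \<in> carrier (tensor_algebra G)"
  shows "\<ominus>\<^bsub>tensor_algebra G\<^esub> a = - a"
proof -
  interpret ring "tensor_algebra G" by (rule tensor_ring)
  show ?thesis
    using assms minus_equality[of "- a" a] by (simp add: tensor_carrier_uminus)
qed


subsection \<open>The ideal of graded commutators\<close>

lemma graded_commutators_carrier: "graded_commutators G \<subseteq> carrier (tensor_algebra G)"
  by (auto simp: graded_commutators_def intro!: tensor_carrier_intros simp: tensor_carrier_word)

theorem commutator_ideal_ideal: "ideal (commutator_ideal G) (tensor_algebra G)"
  unfolding commutator_ideal_def
  by (rule ring.genideal_ideal[OF tensor_ring graded_commutators_carrier])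

lemma commutator_ideal_carrier: "commutator_ideal G \<subseteq> carrier (tensor_algebra G)"
  using ideal.Icarr[OF commutator_ideal_ideal] by blast

lemma commutator_ideal_zero [simp]: "0 \<in> commutator_ideal G"
  using additive_subgroup.zero_closed[OF ideal.axioms(1)[OF commutator_ideal_ideal[of G]]] by simp

lemma commutator_ideal_add:
  "a \<in> commutator_ideal G \<Longrightarrow> b \<in> commutator_ideal G \<Longrightarrow> a + b \<in> commutator_ideal G"
  using additive_subgroup.a_closed[OF ideal.axioms(1)[OF commutator_ideal_ideal[of G]]] by simp

lemma commutator_ideal_left:
  "a \<in> commutator_ideal G \<Longrightarrow> x \<in> carrier (tensor_algebra G) \<Longrightarrow> x * a \<in> commutator_ideal G"
  using ideal.I_l_closed[OF commutator_ideal_ideal[of G]] by simp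

lemma commutator_ideal_right:
  "a \<in> commutator_ideal G \<Longrightarrow> x \<in> carrier (tensor_algebra G) \<Longrightarrow> a * x \<in> commutator_ideal G"
  using ideal.I_r_closed[OF commutator_ideal_ideal[of G]] by simp

lemma commutator_ideal_uminus: "a \<in> commutator_ideal G \<Longrightarrow> - a \<in> commutator_ideal G"
  using commutator_ideal_left[of a G "- 1"] by (simp add: tensor_carrier_uminus)

lemma commutator_ideal_koszul_sign:
  "a \<in> commutator_ideal G \<Longrightarrow> koszul_sign n * a \<in> commutator_ideal G"
  by (simp add: koszul_sign_def commutator_ideal_uminus)

lemma commutator_ideal_diff:
  "a \<in> commutator_ideal G \<Longrightarrow> b \<in> commutator_ideal G \<Longrightarrow> a - b \<in> commutator_ideal G"
  using commutator_ideal_add[of a G "- b"] by (simp add: commutator_ideal_uminus)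

lemma graded_commutator_in_ideal:
  assumes "g \<in> generators G" "h \<in> generators G"
  shows "word [g] * word [h] - koszul_sign (gen_degree G g * gen_degree G h) * (word [h] * word [g])
     \<in> commutator_ideal G"
proof -
  have "word [g, h] - koszul_sign (gen_degree G g * gen_degree G h) * word [h, g]
      \<in> graded_commutators G"
    using assms by (auto simp: graded_commutators_def)
  then show ?thesis
    using ring.genideal_self[OF tensor_ring graded_commutators_carrier, of G]
    by (auto simp: commutator_ideal_def simp flip: word_append)
qed

lemma odd_generator_square:
  assumes "g \<in> generators G" "odd (gen_degree G g)"
  shows "word [g] * word [g] \<in> commutator_ideal G"
proof -
  have "scalar (1/2) * (word [g] * word [g] + word [g] * word [g]) \<in> commutator_ideal G"
    using graded_commutator_in_ideal[OF assms(1) assms(1)] assms(2)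
    by (intro commutator_ideal_left) (simp_all add: koszul_sign_def)
  moreover have "scalar (1/2) * (x + x) = x" for x :: "('a, 'b) generator tensor"
    by (simp add: distrib_left flip: distrib_right single_add)
  ultimately show ?thesis by simp
qed

lemma graded_commutator_word_in_ideal:
  assumes "w \<in> lists (generators G)" "h \<in> generators G"
  shows "word w * word [h] - koszul_sign (word_degree G w * gen_degree G h) * (word [h] * word w)
     \<in> commutator_ideal G"
  using assms(1)
proof (induction w rule: lists.induct)
  case Nil
  show ?case by (simp add: word_degree_def koszul_sign_def word_Nil)
next
  case (Cons g w)
  let ?s = "koszul_sign (gen_degree G g * gen_degree G h) :: ('a, 'b) generator tensor"
  let ?t = "koszul_sign (word_degree G w * gen_degree G h) :: ('a, 'b) generator tensor"
  let ?g = "word [g]" and ?h = "word [h]" and ?w = "word w"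
  have "?g * (?w * ?h - ?t * (?h * ?w)) + ?t * ((?g * ?h - ?s * (?h * ?g)) * ?w) \<in> commutator_ideal G"
    using Cons assms(2)
    by (intro commutator_ideal_add commutator_ideal_left commutator_ideal_koszul_sign
        commutator_ideal_right graded_commutator_in_ideal) (auto simp: tensor_carrier_word)
  also have "?g * (?w * ?h - ?t * (?h * ?w)) + ?t * ((?g * ?h - ?s * (?h * ?g)) * ?w) =
      ?g * ?w * ?h - ?t * ?s * (?h * (?g * ?w))"
    by (simp add: koszul_sign_def algebra_simps)
  also have "?t * ?s = koszul_sign (word_degree G (g # w) * gen_degree G h)"
    by (simp add: word_degree_def distrib_right koszul_sign_def)
  also have "?g * ?w = word (g # w)"
    by (simp flip: word_append)
  finally show ?case .
qed

lemma gen_diff_carrier: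
  assumes "hypergraph G" "g \<in> generators G"
  shows "gen_diff G g \<in> carrier (tensor_algebra G)"
proof (cases g)
  case (Edge e)
  then obtain k where "k > 0" "e \<in> k_edges G k"
    using assms(2) by (auto simp: generators_def edges_def)
  then have "ends G e \<subseteq> verts G" "finite (ends G e)"
    using assms(1) by (auto simp: hypergraph_def intro: card_ge_0_finite)
  then show ?thesis
    by (force simp: Edge tensor_carrier_word generators_def lists_eq_set)
qed simp

lemma graded_commutator_gen_diff_in_ideal:
  assumes "hypergraph G" "g \<in> generators G" "h \<in> generators G"
  shows "gen_diff G g * word [h] -
      koszul_sign ((gen_degree G g + 1) * gen_degree G h) * (word [h] * gen_diff G g)
     \<in> commutator_ideal G"
proof (cases g)
  case (Edge e)
  then obtain w where w: "gen_diff G g = word w" by simp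
  then have "w \<in> lists (generators G)" "word_degree G w = gen_degree G g + 1"
    using gen_diff_carrier[OF assms(1,2)] word_degree_gen_diff[of w G g]
    by (simp_all add: tensor_carrier_word) (simp add: word_def)
  then show ?thesis
    using graded_commutator_word_in_ideal[of w G h] assms(3) by (simp add: w)
qed simp

lemma word_diff_carrier:
  assumes "hypergraph G" "w \<in> lists (generators G)"
  shows "word_diff G w \<in> carrier (tensor_algebra G)"
  using assms(2)
proof (induction w rule: lists.induct)
  case (Cons g w)
  then show ?case
    using gen_diff_carrier[OF assms(1), of g]
    by (auto intro!: tensor_carrier_intros simp: tensor_carrier_word mult.assoc)
qed simp

lemma tensor_diff_carrier:
  assumes "hypergraph G" "a \<in> carrier (tensor_algebra G)"
  shows "tensor_diff G a \<in> carrier (tensor_algebra G)"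
  unfolding tensor_diff_def linear_extension_def
  using assms
  by (intro tensor_carrier_sum tensor_carrier_mult word_diff_carrier) (auto simp: tensor_carrier_iff zero_list_def)

lemma grade_involution_carrier:
  assumes "a \<in> carrier (tensor_algebra G)"
  shows "grade_involution G a \<in> carrier (tensor_algebra G)"
  unfolding grade_involution_def linear_extension_def
  using assms
  by (intro tensor_carrier_sum tensor_carrier_mult[OF tensor_carrier_scalar]
      tensor_carrier_koszul_sign)
    (use assms in \<open>simp only: tensor_carrier_word\<close>, auto simp: tensor_carrier_iff)

lemma graded_commutators_diff:
  assumes "hypergraph G" "r \<in> graded_commutators G"
  shows "tensor_diff G r \<in> commutator_ideal G" "grade_involution G r \<in> commutator_ideal G"
proof -
  obtain g h where gh: "g \<in> generators G" "h \<in> generators G"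
    and "r = word [g, h] - koszul_sign (gen_degree G g * gen_degree G h) * word [h, g]"
    using assms(2) by (auto simp: graded_commutators_def)
  then have r: "r = word [g] * word [h] -
      koszul_sign (gen_degree G g * gen_degree G h) * (word [h] * word [g])"
    by (simp flip: word_append)
  let ?m = "gen_degree G g" and ?n = "gen_degree G h"
  let ?x = "gen_diff G g * word [h] - koszul_sign ((?m + 1) * ?n) * (word [h] * gen_diff G g)"
  let ?y = "gen_diff G h * word [g] - koszul_sign ((?n + 1) * ?m) * (word [g] * gen_diff G h)"
  have "tensor_diff G r = ?x - koszul_sign (?m * ?n) * ?y"
    unfolding r tensor_diff_diff tensor_diff_koszul_sign
    unfolding tensor_diff_mult_general
      tensor_diff_generator grade_involution_word
    by (simp add: koszul_sign_def word_degree_def algebra_simps)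
  then show "tensor_diff G r \<in> commutator_ideal G"
    using graded_commutator_gen_diff_in_ideal[OF assms(1) gh]
      graded_commutator_gen_diff_in_ideal[OF assms(1) gh(2,1)]
    by (simp add: commutator_ideal_diff commutator_ideal_koszul_sign)
  have "grade_involution G r = koszul_sign (?m + ?n) * r"
    unfolding r grade_involution_diff grade_involution_koszul_sign
    unfolding grade_involution_mult
      grade_involution_word
    by (simp add: koszul_sign_def word_degree_def algebra_simps)
  then show "grade_involution G r \<in> commutator_ideal G"
    using graded_commutator_in_ideal[OF gh] by (simp add: r commutator_ideal_koszul_sign)
qed

theorem tensor_diff_commutator_ideal:
  assumes "hypergraph G" "a \<in> commutator_ideal G"
  shows "tensor_diff G a \<in> commutator_ideal G"
proof -
  interpret T: ring "tensor_algebra G" by (rule tensor_ring)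
  define J where "J = {a \<in> commutator_ideal G.
      tensor_diff G a \<in> commutator_ideal G \<and> grade_involution G a \<in> commutator_ideal G}"
  have "ideal J (tensor_algebra G)"
  proof (rule idealI)
    show "subgroup J (add_monoid (tensor_algebra G))"
    proof (rule group.subgroupI)
      show "Group.group (add_monoid (tensor_algebra G))"
        by (rule T.a_group)
      show "J \<subseteq> carrier (add_monoid (tensor_algebra G))"
        using commutator_ideal_carrier[of G] by (auto simp: J_def)
      show "J \<noteq> {}"
        by (auto simp: J_def intro: exI[of _ 0])
      show "inv\<^bsub>add_monoid (tensor_algebra G)\<^esub> a \<in> J" if "a \<in> J" for a
        using that commutator_ideal_carrier[of G] tensor_a_inv[of a G]
        by (auto simp: J_def a_inv_def tensor_diff_uminus grade_involution_uminus
            commutator_ideal_uminus)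
      show "a \<otimes>\<^bsub>add_monoid (tensor_algebra G)\<^esub> b \<in> J" if "a \<in> J" "b \<in> J" for a b
        using that by (auto simp: J_def tensor_diff_add grade_involution_add commutator_ideal_add)
    qed
  qed (use assms(1) in \<open>auto simp: J_def tensor_diff_mult_general grade_involution_mult tensor_ring
      intro!: commutator_ideal_add
      intro: commutator_ideal_left commutator_ideal_right tensor_diff_carrier
        grade_involution_carrier\<close>)
  moreover have "graded_commutators G \<subseteq> J"
    using graded_commutators_diff[OF assms(1)] T.genideal_self[OF graded_commutators_carrier]
    by (auto simp: J_def commutator_ideal_def)
  ultimately have "commutator_ideal G \<subseteq> J"
    unfolding commutator_ideal_def[of G] by (rule T.genideal_minimal)
  then show ?thesis
    using assms(2) by (auto simp: J_def)
qed

lemma gen_diff_component: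
  assumes "hypergraph G" "g \<in> generators G"
  shows "gen_diff G g \<in> tensor_component G (gen_degree G g + 1)"
  using gen_diff_carrier[OF assms] word_degree_gen_diff[of _ G g]
  by (simp add: tensor_component_def)


subsection \<open>Quotient modules\<close>

lemma submoduleD:
  assumes "submodule R N M"
  shows "module R M" "N \<subseteq> carrier M" "\<zero>\<^bsub>M\<^esub> \<in> N"
    and "\<And>x y. x \<in> N \<Longrightarrow> y \<in> N \<Longrightarrow> x \<oplus>\<^bsub>M\<^esub> y \<in> N"
    and "\<And>c x. c \<in> carrier R \<Longrightarrow> x \<in> N \<Longrightarrow> c \<odot>\<^bsub>M\<^esub> x \<in> N"
  using assms unfolding submodule_def by auto

lemma submodule_abelian_subgroup:
  assumes "submodule R N M"
  shows "abelian_subgroup N M"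
proof -
  interpret M: Module.module R M by (rule submoduleD(1)[OF assms])
  note N = submoduleD[OF assms]
  show ?thesis
  proof (rule abelian_subgroupI3)
    show "additive_subgroup N M"
    proof (rule additive_subgroup.intro, rule group.subgroupI)
      show "inv\<^bsub>add_monoid M\<^esub> x \<in> N" if "x \<in> N" for x
      proof -
        have "inv\<^bsub>add_monoid M\<^esub> x = (\<ominus>\<^bsub>R\<^esub> \<one>\<^bsub>R\<^esub>) \<odot>\<^bsub>M\<^esub> x"
          using that N(2) M.smult_l_minus[of "\<one>\<^bsub>R\<^esub>" x] by (auto simp: a_inv_def)
        then show ?thesis
          using N(5)[OF _ that] by simp
      qed
    qed (use N M.a_group in auto)
  qed (rule M.abelian_group_axioms)
qed

lemma quotient_module_simps:
  "carrier (quotient_module M N) = (\<lambda>x. N +>\<^bsub>M\<^esub> x) ` carrier M"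
  "zero (quotient_module M N) = N"
  "add (quotient_module M N) = set_add M"
  by (auto simp: quotient_module_def A_RCOSETS_defs a_r_coset_def)

lemma a_r_coset_iff: "y \<in> N +>\<^bsub>M\<^esub> x \<longleftrightarrow> (\<exists>n\<in>N. y = n \<oplus>\<^bsub>M\<^esub> x)"
  by (auto simp: a_r_coset_def')

lemma quotient_module_smult:
  assumes "submodule R N M" "c \<in> carrier R" "x \<in> carrier M"
  shows "c \<odot>\<^bsub>quotient_module M N\<^esub> (N +>\<^bsub>M\<^esub> x) = N +>\<^bsub>M\<^esub> (c \<odot>\<^bsub>M\<^esub> x)"
proof -
  interpret M: Module.module R M by (rule submoduleD(1)[OF assms(1)])
  interpret N: abelian_subgroup N M by (rule submodule_abelian_subgroup[OF assms(1)])
  note N = submoduleD[OF assms(1)]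
  have "N +>\<^bsub>M\<^esub> (c \<odot>\<^bsub>M\<^esub> y) = N +>\<^bsub>M\<^esub> (c \<odot>\<^bsub>M\<^esub> x)" if "y \<in> N +>\<^bsub>M\<^esub> x" for y
  proof -
    obtain n where n: "n \<in> N" "y = n \<oplus>\<^bsub>M\<^esub> x"
      using \<open>y \<in> N +>\<^bsub>M\<^esub> x\<close> unfolding a_r_coset_iff by (rule bexE)
    then have "n \<in> carrier M"
      using N(2) by (simp add: subset_iff)
    then have "c \<odot>\<^bsub>M\<^esub> y = (c \<odot>\<^bsub>M\<^esub> n) \<oplus>\<^bsub>M\<^esub> (c \<odot>\<^bsub>M\<^esub> x)"
      using assms n(2) by (simp add: M.smult_r_distr)
    then have "c \<odot>\<^bsub>M\<^esub> y \<in> N +>\<^bsub>M\<^esub> (c \<odot>\<^bsub>M\<^esub> x)"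
      using N(5)[OF assms(2) n(1)] unfolding a_r_coset_iff by (intro bexI)
    then show ?thesis
      using N.a_repr_independence'[of _ "c \<odot>\<^bsub>M\<^esub> x"] assms by simp
  qed
  moreover have "x \<in> N +>\<^bsub>M\<^esub> x"
    using N.a_rcos_self assms(3) by blast
  ultimately have "(\<Union>y\<in>N +>\<^bsub>M\<^esub> x. N +>\<^bsub>M\<^esub> (c \<odot>\<^bsub>M\<^esub> y)) = N +>\<^bsub>M\<^esub> (c \<odot>\<^bsub>M\<^esub> x)"
    by (metis (no_types, lifting) SUP_eq_const empty_iff)
  then show ?thesis
    by (simp add: quotient_module_def)
qed

theorem quotient_module_module:
  assumes "submodule R N M"
  shows "module R (quotient_module M N)"
proof -
  interpret M: Module.module R M by (rule submoduleD(1)[OF assms])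
  interpret N: abelian_subgroup N M by (rule submodule_abelian_subgroup[OF assms])
  note simps = quotient_module_simps quotient_module_smult[OF assms] N.a_rcos_sum
  show ?thesis
  proof (rule moduleI)
    show "cring R" by (rule M.R.cring_axioms)
    have zero: "N +>\<^bsub>M\<^esub> \<zero>\<^bsub>M\<^esub> = N"
      using N.a_rcos_const[OF N.zero_closed] .
    show "abelian_group (quotient_module M N)"
    proof (rule abelian_groupI)
      fix X assume "X \<in> carrier (quotient_module M N)"
      then obtain x where x: "x \<in> carrier M" "X = N +>\<^bsub>M\<^esub> x"
        by (auto simp: simps)
      have "N +>\<^bsub>M\<^esub> (\<ominus>\<^bsub>M\<^esub> x) \<in> carrier (quotient_module M N)"
        using x by (auto simp: simps)
      moreover have "(N +>\<^bsub>M\<^esub> (\<ominus>\<^bsub>M\<^esub> x)) \<oplus>\<^bsub>quotient_module M N\<^esub> X = \<zero>\<^bsub>quotient_module M N\<^esub>"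
        using x by (simp add: simps zero M.l_neg)
      ultimately show "\<exists>Y\<in>carrier (quotient_module M N).
          Y \<oplus>\<^bsub>quotient_module M N\<^esub> X = \<zero>\<^bsub>quotient_module M N\<^esub>"
        by blast
      have "(N +>\<^bsub>M\<^esub> \<zero>\<^bsub>M\<^esub>) \<oplus>\<^bsub>quotient_module M N\<^esub> X = X"
        using x by (simp add: simps del: zero)
      then show "\<zero>\<^bsub>quotient_module M N\<^esub> \<oplus>\<^bsub>quotient_module M N\<^esub> X = X"
        by (simp add: simps zero)
    next
      have "N +>\<^bsub>M\<^esub> \<zero>\<^bsub>M\<^esub> \<in> carrier (quotient_module M N)"
        by (auto simp: quotient_module_simps intro!: imageI)
      then show "\<zero>\<^bsub>quotient_module M N\<^esub> \<in> carrier (quotient_module M N)"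
        by (simp add: zero quotient_module_simps(2))
    qed (auto simp: simps M.a_ac intro!: imageI)
  qed (auto simp: simps M.smult_l_distr M.smult_r_distr M.smult_assoc1 intro!: imageI)
qed


subsection \<open>The Maurer--Cartan complex\<close>

lemma commutator_ideal_submodule: "submodule class_ring (commutator_ideal G) (tensor_algebra G)"
  unfolding submodule_def
  by (simp add: tensor_module commutator_ideal_carrier commutator_ideal_add commutator_ideal_left)

theorem MC_algebra_module: "module class_ring (MC_algebra G)"
  unfolding MC_algebra_def by (rule quotient_module_module[OF commutator_ideal_submodule])

theorem MC_algebra_ring: "ring (MC_algebra G)"
proof -
  interpret Q: ring "tensor_algebra G Quot commutator_ideal G"
    by (rule ideal.quotient_is_ring[OF commutator_ideal_ideal])
  have eqs: "carrier (MC_algebra G) = carrier (tensor_algebra G Quot commutator_ideal G)"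
    "mult (MC_algebra G) = mult (tensor_algebra G Quot commutator_ideal G)"
    "one (MC_algebra G) = one (tensor_algebra G Quot commutator_ideal G)"
    "add (MC_algebra G) = add (tensor_algebra G Quot commutator_ideal G)"
    by (simp_all add: MC_algebra_def quotient_module_def FactRing_def)
  interpret M: Module.module class_ring "MC_algebra G"
    by (rule MC_algebra_module)
  show ?thesis
    by (rule ringI[OF M.abelian_group_axioms monoidI])
      (simp_all add: eqs Q.m_assoc Q.l_distr Q.r_distr)
qed

lemma MC_algebra_zero: "\<zero>\<^bsub>MC_algebra G\<^esub> = commutator_ideal G"
  by (simp add: MC_algebra_def quotient_module_simps)

abbreviation (input) MC_class ::
  "('v, 'e) hypergraph \<Rightarrow> ('v, 'e) generator tensor \<Rightarrow> ('v, 'e) generator tensor set" where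
  "MC_class G a \<equiv> commutator_ideal G +>\<^bsub>tensor_algebra G\<^esub> a"

lemma MC_class_zero: "MC_class G 0 = commutator_ideal G"
  by (auto simp: a_r_coset_def')

lemma MC_class_eq_iff:
  assumes "a \<in> carrier (tensor_algebra G)" "b \<in> carrier (tensor_algebra G)"
  shows "MC_class G a = MC_class G b \<longleftrightarrow> a - b \<in> commutator_ideal G"
proof
  assume eq: "MC_class G a = MC_class G b"
  have "a \<in> MC_class G a"
    by (auto simp: a_r_coset_def' intro: bexI[of _ 0])
  then show "a - b \<in> commutator_ideal G"
    unfolding eq by (auto simp: a_r_coset_def')
next
  assume ab: "a - b \<in> commutator_ideal G"
  have sub: "MC_class G x \<subseteq> MC_class G y" if "x - y \<in> commutator_ideal G" for x y
  proof
    fix z assume "z \<in> MC_class G x"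
    then obtain i where "i \<in> commutator_ideal G" "z = i + x"
      by (auto simp: a_r_coset_def')
    then have "z = (i + (x - y)) + y" "i + (x - y) \<in> commutator_ideal G"
      using commutator_ideal_add[OF _ that] by simp_all
    then show "z \<in> MC_class G y"
      unfolding a_r_coset_def' tensor_algebra_simps by blast
  qed
  show "MC_class G a = MC_class G b"
    using sub[OF ab] sub[of b a] commutator_ideal_uminus[OF ab] by simp
qed

lemma MC_class_add:
  assumes "a \<in> carrier (tensor_algebra G)" "b \<in> carrier (tensor_algebra G)"
  shows "MC_class G a \<oplus>\<^bsub>MC_algebra G\<^esub> MC_class G b = MC_class G (a + b)"
  using abelian_subgroup.a_rcos_sum[OF submodule_abelian_subgroup[OF commutator_ideal_submodule]] assms
  by (simp add: MC_algebra_def quotient_module_simps)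

lemma MC_class_smult:
  assumes "a \<in> carrier (tensor_algebra G)"
  shows "c \<odot>\<^bsub>MC_algebra G\<^esub> MC_class G a = MC_class G (scalar c * a)"
  using quotient_module_smult[OF commutator_ideal_submodule, of c a] assms
  by (simp add: MC_algebra_def)

lemma MC_class_mult:
  assumes "a \<in> carrier (tensor_algebra G)" "b \<in> carrier (tensor_algebra G)"
  shows "MC_class G a \<otimes>\<^bsub>MC_algebra G\<^esub> MC_class G b = MC_class G (a * b)"
  using ideal.rcoset_mult_add[OF commutator_ideal_ideal] assms
  by (simp add: MC_algebra_def quotient_module_def)

lemma MC_diff_class:
  assumes "hypergraph G" "a \<in> carrier (tensor_algebra G)"
  shows "MC_diff G (MC_class G a) = MC_class G (tensor_diff G a)"
proof -
  have "MC_class G (tensor_diff G b) = MC_class G (tensor_diff G a)" if "b \<in> MC_class G a" for b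
  proof -
    obtain i where i: "i \<in> commutator_ideal G" "b = i + a"
      using \<open>b \<in> MC_class G a\<close> by (auto simp: a_r_coset_def')
    then have "tensor_diff G b - tensor_diff G a \<in> commutator_ideal G" "b \<in> carrier (tensor_algebra G)"
      using tensor_diff_commutator_ideal[OF assms(1) i(1)] assms(2) commutator_ideal_carrier[of G]
      by (auto simp: tensor_diff_add intro!: tensor_carrier_add)
    then show ?thesis
      using assms by (simp add: MC_class_eq_iff tensor_diff_carrier)
  qed
  moreover have "a \<in> MC_class G a"
    by (auto simp: a_r_coset_def' intro: bexI[of _ 0])
  ultimately show ?thesis
    unfolding MC_diff_def by (metis (no_types, lifting) SUP_eq_const empty_iff)
qed

lemma tensor_component_carrier: "a \<in> tensor_component G n \<Longrightarrow> a \<in> carrier (tensor_algebra G)"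
  by (simp add: tensor_component_def)

lemma tensor_component_add:
  assumes "a \<in> tensor_component G n" "b \<in> tensor_component G n"
  shows "a + b \<in> tensor_component G n"
  using assms keys_add[of a b] by (auto simp: tensor_component_def intro: tensor_carrier_add)

lemma tensor_component_zero: "0 \<in> tensor_component G n"
  by (simp add: tensor_component_def)

lemma tensor_component_one: "1 \<in> tensor_component G 0"
  by (simp add: tensor_component_def word_degree_def zero_list_def)

lemma tensor_component_mult:
  assumes "a \<in> tensor_component G m" "b \<in> tensor_component G n"
  shows "a * b \<in> tensor_component G (m + n)"
proof -
  have "word_degree G w = m + n" if "w \<in> Poly_Mapping.keys (a * b)" for w
  proof -
    obtain u v where "w = u @ v" "u \<in> Poly_Mapping.keys a" "v \<in> Poly_Mapping.keys b"
      using \<open>w \<in> Poly_Mapping.keys (a * b)\<close> keys_mult[of a b] unfolding plus_list_def by blast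
    then show ?thesis
      using assms by (simp add: tensor_component_def word_degree_append)
  qed
  then show ?thesis
    using assms by (auto simp: tensor_component_def intro: tensor_carrier_mult)
qed

lemma tensor_component_scalar:
  assumes "a \<in> tensor_component G n"
  shows "scalar c * a \<in> tensor_component G n"
proof -
  have "scalar c \<in> tensor_component G 0"
    by (simp add: tensor_component_def tensor_carrier_scalar)
      (simp add: word_degree_def zero_list_def)
  then show ?thesis
    using tensor_component_mult[OF _ assms] by fastforce
qed

lemma tensor_component_koszul_sign:
  assumes "a \<in> tensor_component G n"
  shows "koszul_sign m * a \<in> tensor_component G n"
  using assms by (simp add: koszul_sign_def tensor_component_def tensor_carrier_uminus)

lemma tensor_component_sum:
  "(\<And>x. x \<in> A \<Longrightarrow> f x \<in> tensor_component G n) \<Longrightarrow> sum f A \<in> tensor_component G n"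
  by (induction A rule: infinite_finite_induct)
    (simp_all add: tensor_component_add tensor_component_zero)

lemma tensor_component_word:
  "word w \<in> tensor_component G n \<longleftrightarrow> w \<in> lists (generators G) \<and> word_degree G w = n"
  by (simp add: tensor_component_def tensor_carrier_word) (simp add: word_def)

lemma word_diff_component:
  assumes "hypergraph G" "w \<in> lists (generators G)"
  shows "word_diff G w \<in> tensor_component G (word_degree G w + 1)"
  using assms(2)
proof (induction w rule: lists.induct)
  case Nil
  show ?case by (simp add: tensor_component_zero)
next
  case (Cons g w)
  let ?n = "word_degree G (g # w) + 1"
  have deg: "?n = gen_degree G g + 1 + word_degree G w" "?n = gen_degree G g + (word_degree G w + 1)"
    by (simp_all add: word_degree_def)
  have "gen_diff G g * word w \<in> tensor_component G ?n"
    unfolding deg(1) using Cons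
    by (intro tensor_component_mult gen_diff_component[OF assms(1)])
      (simp_all add: tensor_component_word)
  moreover have "word [g] * word_diff G w \<in> tensor_component G ?n"
    unfolding deg(2) using Cons
    by (intro tensor_component_mult) (simp_all add: tensor_component_word word_degree_def)
  ultimately show ?case
    unfolding word_diff.simps mult.assoc
    by (intro tensor_component_add tensor_component_koszul_sign)
qed

lemma tensor_diff_component:
  assumes "hypergraph G" "a \<in> tensor_component G n"
  shows "tensor_diff G a \<in> tensor_component G (n + 1)"
  unfolding tensor_diff_def linear_extension_def
proof (intro tensor_component_sum tensor_component_scalar)
  fix w assume "w \<in> Poly_Mapping.keys a"
  then have "w \<in> lists (generators G)" "word_degree G w = n"
    using assms(2) by (auto simp: tensor_component_def tensor_carrier_iff)
  then show "word_diff G w \<in> tensor_component G (n + 1)"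
    using word_diff_component[OF assms(1)] by blast
qed

theorem MC_diff_component:
  assumes "hypergraph G" "X \<in> MC_component G n"
  shows "MC_diff G X \<in> MC_component G (n + 1)"
  using assms
  by (auto simp: MC_component_def MC_diff_class tensor_component_carrier tensor_diff_component)

theorem MC_diff_MC_diff:
  assumes "hypergraph G" "X \<in> carrier (MC_algebra G)"
  shows "MC_diff G (MC_diff G X) = \<zero>\<^bsub>MC_algebra G\<^esub>"
  using assms
  by (auto simp: MC_algebra_zero MC_diff_class tensor_diff_carrier tensor_diff_tensor_diff MC_class_zero)
    (auto simp: MC_algebra_def quotient_module_simps MC_diff_class tensor_diff_carrier
      tensor_diff_tensor_diff MC_class_zero)

theorem MC_diff_mult:
  assumes "hypergraph G" "X \<in> MC_component G m" "Y \<in> MC_component G n"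
  shows "MC_diff G (X \<otimes>\<^bsub>MC_algebra G\<^esub> Y) =
    (MC_diff G X \<otimes>\<^bsub>MC_algebra G\<^esub> Y) \<oplus>\<^bsub>MC_algebra G\<^esub>
    (koszul_sign m \<odot>\<^bsub>MC_algebra G\<^esub> (X \<otimes>\<^bsub>MC_algebra G\<^esub> MC_diff G Y))"
proof -
  obtain a b where a: "a \<in> tensor_component G m" "X = MC_class G a"
    and b: "b \<in> tensor_component G n" "Y = MC_class G b"
    using assms(2,3) by (auto simp: MC_component_def)
  have carr: "a \<in> carrier (tensor_algebra G)" "b \<in> carrier (tensor_algebra G)"
    using a b by (auto intro: tensor_component_carrier)
  have "scalar (koszul_sign m) = (koszul_sign m :: ('a, 'b) generator tensor)"
    by (simp add: koszul_sign_def single_uminus)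
  then show ?thesis
    using carr assms(1)
    by (simp add: a(2) b(2) MC_class_mult MC_diff_class MC_class_smult MC_class_add
        tensor_carrier_mult tensor_diff_carrier tensor_diff_mult[OF a(1)] mult.assoc
        tensor_carrier_koszul_sign)
qed


subsection \<open>Cohomology\<close>

lemma cocycles_iff:
  assumes "hypergraph G"
  shows "X \<in> cocycles G n \<longleftrightarrow>
    (\<exists>a\<in>tensor_component G n. X = MC_class G a \<and> tensor_diff G a \<in> commutator_ideal G)"
proof -
  have "MC_diff G (MC_class G a) = commutator_ideal G \<longleftrightarrow> tensor_diff G a \<in> commutator_ideal G"
    if "a \<in> tensor_component G n" for a
    using MC_class_eq_iff[of "tensor_diff G a" G 0] assms that
    by (simp add: MC_class_zero MC_diff_class tensor_diff_carrier tensor_component_carrier)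
  then show ?thesis
    by (auto simp: cocycles_def MC_component_def MC_algebra_zero)
qed

lemma cocycles_submodule:
  assumes "hypergraph G"
  shows "submodule class_ring (cocycles G n) (MC_algebra G)"
  unfolding submodule_def
proof (intro conjI allI impI)
  note [simp] = cocycles_iff[OF assms]
  show "module class_ring (MC_algebra G)" by (rule MC_algebra_module)
  show "cocycles G n \<subseteq> carrier (MC_algebra G)"
    by (auto simp: MC_algebra_def quotient_module_simps intro!: imageI tensor_component_carrier)
  show "\<zero>\<^bsub>MC_algebra G\<^esub> \<in> cocycles G n"
    by (auto simp: MC_algebra_zero MC_class_zero tensor_component_zero intro!: bexI[of _ 0])
  show "X \<oplus>\<^bsub>MC_algebra G\<^esub> Y \<in> cocycles G n" if "X \<in> cocycles G n" "Y \<in> cocycles G n" for X Y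
  proof -
    obtain a b where "a \<in> tensor_component G n" "X = MC_class G a" "tensor_diff G a \<in> commutator_ideal G"
      and "b \<in> tensor_component G n" "Y = MC_class G b" "tensor_diff G b \<in> commutator_ideal G"
      using \<open>X \<in> cocycles G n\<close> \<open>Y \<in> cocycles G n\<close> unfolding cocycles_iff[OF assms] by blast
    then show ?thesis
      unfolding cocycles_iff[OF assms]
      by (intro bexI[of _ "a + b"])
        (simp_all add: MC_class_add tensor_component_carrier tensor_diff_add tensor_component_add
          commutator_ideal_add)
  qed
  show "c \<odot>\<^bsub>MC_algebra G\<^esub> X \<in> cocycles G n" if "c \<in> carrier class_ring" "X \<in> cocycles G n" for c X
  proof -
    obtain a where "a \<in> tensor_component G n" "X = MC_class G a" "tensor_diff G a \<in> commutator_ideal G"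
      using \<open>X \<in> cocycles G n\<close> by auto
    then show ?thesis
      unfolding cocycles_iff[OF assms]
      by (intro bexI[of _ "scalar c * a"])
        (simp_all add: MC_class_smult tensor_component_carrier tensor_diff_scalar
          tensor_component_scalar commutator_ideal_left)
  qed
qed

lemma coboundaries_iff:
  assumes "hypergraph G"
  shows "X \<in> coboundaries G n \<longleftrightarrow> (\<exists>a\<in>tensor_component G (n - 1). X = MC_class G (tensor_diff G a))"
  using assms
  by (auto simp: coboundaries_def MC_component_def MC_diff_class image_iff tensor_component_carrier)

lemma coboundaries_subset_cocycles:
  assumes "hypergraph G"
  shows "coboundaries G n \<subseteq> cocycles G n"
proof
  fix X assume "X \<in> coboundaries G n"
  then obtain a where "a \<in> tensor_component G (n - 1)" "X = MC_class G (tensor_diff G a)"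
    using coboundaries_iff[OF assms] by blast
  then show "X \<in> cocycles G n"
    using tensor_diff_component[OF assms, of a "n - 1"]
    by (auto simp: cocycles_iff[OF assms] tensor_diff_tensor_diff)
qed

lemma coboundaries_submodule:
  assumes "hypergraph G"
  shows "submodule class_ring (coboundaries G n) (MC_algebra G\<lparr>carrier := cocycles G n\<rparr>)"
  unfolding submodule_def
proof (intro conjI allI impI)
  note [simp] = coboundaries_iff[OF assms]
  have carr: "tensor_diff G a \<in> carrier (tensor_algebra G)" if "a \<in> tensor_component G m" for a m
    using that by (intro tensor_diff_carrier[OF assms] tensor_component_carrier)
  show "module class_ring (MC_algebra G\<lparr>carrier := cocycles G n\<rparr>)"
    by (rule module.submodule_is_module[OF MC_algebra_module cocycles_submodule[OF assms]])
  show "coboundaries G n \<subseteq> carrier (MC_algebra G\<lparr>carrier := cocycles G n\<rparr>)"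
    using coboundaries_subset_cocycles[OF assms] by simp
  show "\<zero>\<^bsub>MC_algebra G\<lparr>carrier := cocycles G n\<rparr>\<^esub> \<in> coboundaries G n"
    by (auto simp: MC_algebra_zero MC_class_zero tensor_component_zero intro!: bexI[of _ 0])
  show "X \<oplus>\<^bsub>MC_algebra G\<lparr>carrier := cocycles G n\<rparr>\<^esub> Y \<in> coboundaries G n"
    if "X \<in> coboundaries G n" "Y \<in> coboundaries G n" for X Y
  proof -
    obtain a b where "a \<in> tensor_component G (n - 1)" "X = MC_class G (tensor_diff G a)"
      and "b \<in> tensor_component G (n - 1)" "Y = MC_class G (tensor_diff G b)"
      using \<open>X \<in> coboundaries G n\<close> \<open>Y \<in> coboundaries G n\<close> unfolding coboundaries_iff[OF assms] by blast
    then show ?thesis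
      unfolding coboundaries_iff[OF assms]
      by (intro bexI[of _ "a + b"])
        (simp_all add: MC_class_add carr tensor_diff_add tensor_component_add)
  qed
  show "c \<odot>\<^bsub>MC_algebra G\<lparr>carrier := cocycles G n\<rparr>\<^esub> X \<in> coboundaries G n"
    if "c \<in> carrier class_ring" "X \<in> coboundaries G n" for c X
  proof -
    obtain a where "a \<in> tensor_component G (n - 1)" "X = MC_class G (tensor_diff G a)"
      using \<open>X \<in> coboundaries G n\<close> unfolding coboundaries_iff[OF assms] by blast
    then show ?thesis
      unfolding coboundaries_iff[OF assms]
      by (intro bexI[of _ "scalar c * a"])
        (simp_all add: MC_class_smult carr tensor_diff_scalar tensor_component_scalar)
  qed
qed

theorem cohomology_vectorspace:
  assumes "hypergraph G"
  shows "vectorspace class_ring (cohomology G n)"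
  unfolding cohomology_def
  by (intro vectorspace.intro quotient_module_module[OF coboundaries_submodule[OF assms]]
      class_field.field_axioms)

end

(*
  Let h be the odd derivation sending x_i to x_e when e is the (unique, by simplicity) 1-edge with
  vertex i, and every other generator to 0. It preserves the commutator ideal, so L = dh + hd is zero
  on cohomology. On a word L acts as multiplication by its weight, the number of letters x_e and x_i
  coming from 1-edges, up to words in which a larger edge has been replaced by vertices. Giving larger
  edges a big level turns the latter words into lower-order terms. In degree n a word of level above
  (|V| + 1) n has positive weight, so applying factors 1 - L/j lowers the level of a cocycle within its
  cohomology class. Hence every class is represented in bounded level, and only finitely many words
  have given degree and bounded level. Everything happens in the tensor algebra, so no basis of the
  Maurer-Cartan algebra is needed.
*)

theory Submission
  imports Defs
begin

section \<open>Contraction against the 1-edges\<close>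

definition has_loop :: "('v, 'e) hypergraph \<Rightarrow> 'v \<Rightarrow> bool" where
  "has_loop G i \<longleftrightarrow> (\<exists>e\<in>edges G. ends G e = {i})"

text \<open>Simplicity makes the choice unique, see \<open>loop_eq\<close>; uses are guarded by
  \<open>has_loop\<close>.\<close>

definition loop :: "('v, 'e) hypergraph \<Rightarrow> 'v \<Rightarrow> 'e" where
  "loop G i = (SOME e. e \<in> edges G \<and> ends G e = {i})"

lemma loop:
  assumes "has_loop G i"
  shows "loop G i \<in> edges G" "ends G (loop G i) = {i}"
  using someI_ex[of "\<lambda>e. e \<in> edges G \<and> ends G e = {i}"] assms
  by (auto simp: has_loop_def loop_def)

lemma simple_hypergraph_inj:
  "simple_hypergraph G \<Longrightarrow> inj_on (ends G) (edges G)"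
  unfolding simple_hypergraph_def inj_on_def by (metis Diff_cancel Un_empty)

lemma loop_eq:
  assumes "simple_hypergraph G" "e \<in> edges G" "ends G e = {i}"
  shows "has_loop G i" "loop G i = e"
proof -
  show *: "has_loop G i"
    using assms by (auto simp: has_loop_def)
  show "loop G i = e"
    using simple_hypergraph_inj[OF assms(1)] loop[OF *] assms(2,3) by (auto dest: inj_onD)
qed

lemma edges_ends:
  assumes "hypergraph G" "e \<in> edges G"
  shows "ends G e \<subseteq> verts G" "finite (ends G e)" "card (ends G e) > 0"
  using assms by (auto simp: hypergraph_def edges_def intro: card_ge_0_finite)

text \<open>Simplicity makes \<open>ends\<close> embed the edges into the power set of the
  vertices.\<close>

lemma finite_generators:
  assumes "hypergraph G" "finite_hypergraph G" "simple_hypergraph G"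
  shows "finite (generators G)"
proof -
  have "ends G ` edges G \<subseteq> Pow (verts G)"
    using edges_ends(1)[OF assms(1)] by blast
  then have "finite (edges G)"
    using assms(2) simple_hypergraph_inj[OF assms(3)]
    by (metis finite_Pow_iff finite_hypergraph_def finite_imageD finite_subset)
  then show ?thesis
    using assms(2) by (simp add: generators_def finite_hypergraph_def)
qed

section \<open>The contraction as an odd derivation\<close>

fun gen_contr :: "('v, 'e) hypergraph \<Rightarrow> ('v, 'e) generator \<Rightarrow> ('v, 'e) generator tensor" where
  "gen_contr G (Vertex i) = (if has_loop G i then word [Edge (loop G i)] else 0)"
| "gen_contr G (Edge e) = 0"

text \<open>The same sign recursion as for \<open>word_diff\<close>, which makes this an odd
  derivation too, of degree -1.\<close>

fun word_contr :: "('v, 'e) hypergraph \<Rightarrow> ('v, 'e) generator list \<Rightarrow> ('v, 'e) generator tensor" where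
  "word_contr G [] = 0"
| "word_contr G (g # w) =
     gen_contr G g * word w + koszul_sign (gen_degree G g) * word [g] * word_contr G w"

definition tensor_contr ::
  "('v, 'e) hypergraph \<Rightarrow> ('v, 'e) generator tensor \<Rightarrow> ('v, 'e) generator tensor" where
  "tensor_contr G = linear_extension (word_contr G)"

text \<open>Reduces later sign computations to one nonzero case: a generator of degree 1 sent to one
  of degree 0.\<close>

lemma gen_contr_cases:
  obtains "gen_contr G g = 0"
  | e where "gen_contr G g = word [Edge e]" "e \<in> edges G" "gen_degree G g = 1"
      "gen_degree G (Edge e) = 0"
proof (cases "gen_contr G g = 0")
  case False
  then obtain i where "g = Vertex i" "has_loop G i"
    by (cases g) (auto split: if_splits)
  then show ?thesis
    using that(2)[of "loop G i"] loop[of G i] by simp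
qed (use that in blast)

lemma tensor_contr_add: "tensor_contr G (a + b) = tensor_contr G a + tensor_contr G b"
  by (simp add: tensor_contr_def linear_extension_add)

lemma tensor_contr_zero [simp]: "tensor_contr G 0 = 0"
  by (simp add: tensor_contr_def)

lemma tensor_contr_uminus: "tensor_contr G (- a) = - tensor_contr G a"
  by (simp add: tensor_contr_def linear_extension_uminus)

lemma tensor_contr_diff: "tensor_contr G (a - b) = tensor_contr G a - tensor_contr G b"
  by (simp add: tensor_contr_def linear_extension_diff)

lemma tensor_contr_scalar: "tensor_contr G (scalar c * a) = scalar c * tensor_contr G a"
  by (simp add: tensor_contr_def linear_extension_scalar)

lemma tensor_contr_word [simp]: "tensor_contr G (word w) = word_contr G w"
  by (simp add: tensor_contr_def)

lemma tensor_contr_koszul_sign: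
  "tensor_contr G (koszul_sign m * a) = koszul_sign m * tensor_contr G a"
  by (simp add: koszul_sign_def tensor_contr_uminus)

lemma word_Cons: "word (g # w) = word [g] * word w"
  using word_append[of "[g]" w] by simp

lemma word_contr_append:
  "word_contr G (u @ v) =
     word_contr G u * word v + koszul_sign (word_degree G u) * word u * word_contr G v"
proof (induction u)
  case Nil
  show ?case by (simp add: word_degree_def koszul_sign_def word_Nil)
next
  case (Cons g u)
  have deg: "word_degree G (g # u) = gen_degree G g + word_degree G u"
    by (simp add: word_degree_def)
  show ?case
    unfolding append_Cons word_contr.simps Cons.IH deg word_append word_Cons[of g u]
    by (auto simp: koszul_sign_def algebra_simps)
qed

text \<open>The graded Leibniz rule. The sign is carried by \<open>grade_involution\<close>, so that
  inhomogeneous \<open>a\<close> is covered; by bilinearity only words have to be checked.\<close>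

lemma tensor_contr_mult:
  "tensor_contr G (a * b) = tensor_contr G a * b + grade_involution G a * tensor_contr G b"
proof (induction a rule: tensor_induct)
  case (monomial c u)
  show ?case
  proof (induction b rule: tensor_induct)
    case (monomial d v)
    have "tensor_contr G (word u * word v) =
        tensor_contr G (word u) * word v + grade_involution G (word u) * tensor_contr G (word v)"
      by (simp add: word_contr_append grade_involution_word flip: word_append)
    then show ?case
      by (simp only: scalar_mult_scalar_mult grade_involution_scalar tensor_contr_scalar distrib_left)
  qed (simp_all add: distrib_left tensor_contr_add algebra_simps)
qed (simp_all add: distrib_right tensor_contr_add grade_involution_add algebra_simps)

lemma tensor_contr_generator: "tensor_contr G (word [g]) = gen_contr G g"
  by (simp add: word_Nil)

lemma grade_involution_gen_contr:
  "grade_involution G (gen_contr G g) = - (koszul_sign (gen_degree G g) * gen_contr G g)"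
  by (cases rule: gen_contr_cases[of G g])
    (simp_all add: grade_involution_word koszul_sign_def word_degree_def)

lemma gen_contr_component:
  assumes "g \<in> generators G"
  shows "gen_contr G g \<in> tensor_component G (gen_degree G g - 1)"
  using assms
  by (cases rule: gen_contr_cases[of G g])
    (auto simp: tensor_component_zero tensor_component_word word_degree_def generators_def)

lemma word_contr_component:
  assumes "w \<in> lists (generators G)"
  shows "word_contr G w \<in> tensor_component G (word_degree G w - 1)"
  using assms
proof (induction w rule: lists.induct)
  case Nil
  show ?case by (simp add: tensor_component_zero)
next
  case (Cons g w)
  let ?n = "word_degree G (g # w) - 1"
  have deg: "?n = gen_degree G g - 1 + word_degree G w" "?n = gen_degree G g + (word_degree G w - 1)"
    by (simp_all add: word_degree_def)
  have "gen_contr G g * word w \<in> tensor_component G ?n"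
    unfolding deg(1) using Cons
    by (intro tensor_component_mult gen_contr_component) (simp_all add: tensor_component_word)
  moreover have "word [g] * word_contr G w \<in> tensor_component G ?n"
    unfolding deg(2) using Cons
    by (intro tensor_component_mult) (simp_all add: tensor_component_word word_degree_def)
  ultimately show ?case
    unfolding word_contr.simps mult.assoc
    by (intro tensor_component_add tensor_component_koszul_sign)
qed

lemma tensor_contr_component:
  assumes "a \<in> tensor_component G n"
  shows "tensor_contr G a \<in> tensor_component G (n - 1)"
  unfolding tensor_contr_def linear_extension_def
proof (intro tensor_component_sum tensor_component_scalar)
  fix w assume "w \<in> Poly_Mapping.keys a"
  then have "w \<in> lists (generators G)" "word_degree G w = n"
    using assms by (auto simp: tensor_component_def tensor_carrier_iff)
  then show "word_contr G w \<in> tensor_component G (n - 1)"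
    using word_contr_component by blast
qed

lemma tensor_contr_carrier:
  assumes "a \<in> carrier (tensor_algebra G)"
  shows "tensor_contr G a \<in> carrier (tensor_algebra G)"
  unfolding tensor_contr_def linear_extension_def
proof (intro tensor_carrier_sum tensor_carrier_mult tensor_carrier_scalar)
  fix w assume "w \<in> Poly_Mapping.keys a"
  then show "word_contr G w \<in> carrier (tensor_algebra G)"
    using assms by (intro tensor_component_carrier[OF word_contr_component])
      (auto simp: tensor_carrier_iff)
qed

section \<open>Compatibility with the commutator ideal\<close>

text \<open>A nonzero contraction is itself a generator, of degree 0, so this is a defining
  relation. There \<open>gen_degree G g + 1\<close> is 2, hence the sign is +1, as it is for degree
  0.\<close>

lemma gen_contr_commute_in_ideal:
  assumes "g \<in> generators G" "h \<in> generators G"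
  shows "gen_contr G g * word [h] -
      koszul_sign ((gen_degree G g + 1) * gen_degree G h) * (word [h] * gen_contr G g)
     \<in> commutator_ideal G"
proof (cases rule: gen_contr_cases[of G g])
  case (2 e)
  then have "Edge e \<in> generators G"
    by (simp add: generators_def)
  from graded_commutator_in_ideal[OF this assms(2)] show ?thesis
    using 2 by (simp add: koszul_sign_def)
qed simp

text \<open>By the Leibniz rule, contracting a graded commutator gives a signed sum of two graded
  commutators, each with one entry contracted.\<close>

lemma graded_commutators_contr:
  assumes "r \<in> graded_commutators G"
  shows "tensor_contr G r \<in> commutator_ideal G"
proof -
  obtain g h where gh: "g \<in> generators G" "h \<in> generators G"
    and "r = word [g, h] - koszul_sign (gen_degree G g * gen_degree G h) * word [h, g]"
    using assms by (auto simp: graded_commutators_def)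
  then have r: "r = word [g] * word [h] -
      koszul_sign (gen_degree G g * gen_degree G h) * (word [h] * word [g])"
    by (simp flip: word_append)
  let ?m = "gen_degree G g" and ?n = "gen_degree G h"
  let ?x = "gen_contr G g * word [h] - koszul_sign ((?m + 1) * ?n) * (word [h] * gen_contr G g)"
  let ?y = "gen_contr G h * word [g] - koszul_sign ((?n + 1) * ?m) * (word [g] * gen_contr G h)"
  have "tensor_contr G r = ?x - koszul_sign (?m * ?n) * ?y"
    unfolding r tensor_contr_diff tensor_contr_koszul_sign
    unfolding tensor_contr_mult tensor_contr_generator grade_involution_word
    by (simp add: koszul_sign_def word_degree_def algebra_simps)
  then show ?thesis
    using gen_contr_commute_in_ideal[OF gh] gen_contr_commute_in_ideal[OF gh(2,1)]
    by (simp add: commutator_ideal_diff commutator_ideal_koszul_sign)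
qed

lemma tensor_contr_commutator_ideal:
  fixes G :: "('v::linorder, 'e) hypergraph"
  assumes "hypergraph G" "a \<in> commutator_ideal G"
  shows "tensor_contr G a \<in> commutator_ideal G"
proof -
  interpret T: ring "tensor_algebra G" by (rule tensor_ring)
  \<comment> \<open>The Leibniz rule applies \<open>grade_involution\<close> to the left factor, so
    closure under multiplication requires stability under both maps.\<close>
  define J where "J = {a \<in> commutator_ideal G.
      tensor_contr G a \<in> commutator_ideal G \<and> grade_involution G a \<in> commutator_ideal G}"
  have "ideal J (tensor_algebra G)"
  proof (rule idealI)
    show "subgroup J (add_monoid (tensor_algebra G))"
    proof (rule group.subgroupI)
      show "Group.group (add_monoid (tensor_algebra G))"
        by (rule T.a_group)
      show "J \<subseteq> carrier (add_monoid (tensor_algebra G))"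
        using commutator_ideal_carrier[of G] by (auto simp: J_def)
      show "J \<noteq> {}"
        by (auto simp: J_def intro: exI[of _ 0])
      show "inv\<^bsub>add_monoid (tensor_algebra G)\<^esub> a \<in> J" if "a \<in> J" for a
        using that commutator_ideal_carrier[of G] tensor_a_inv[of a G]
        by (auto simp: J_def a_inv_def tensor_contr_uminus grade_involution_uminus
            commutator_ideal_uminus)
      show "a \<otimes>\<^bsub>add_monoid (tensor_algebra G)\<^esub> b \<in> J" if "a \<in> J" "b \<in> J" for a b
        using that by (auto simp: J_def tensor_contr_add grade_involution_add commutator_ideal_add)
    qed
  qed (auto simp: J_def tensor_contr_mult grade_involution_mult tensor_ring
      intro!: commutator_ideal_add
      intro: commutator_ideal_left commutator_ideal_right tensor_contr_carrier
        grade_involution_carrier)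
  moreover have "graded_commutators G \<subseteq> J"
    using graded_commutators_contr graded_commutators_diff(2)[OF assms(1)]
      T.genideal_self[OF graded_commutators_carrier]
    by (auto simp: J_def commutator_ideal_def)
  ultimately have "commutator_ideal G \<subseteq> J"
    unfolding commutator_ideal_def[of G] by (rule T.genideal_minimal)
  then show ?thesis
    using assms(2) by (auto simp: J_def)
qed


section \<open>The Laplacian and the level filtration\<close>

text \<open>The graded commutator of two odd derivations; the contraction is a homotopy from it to
  zero.\<close>

definition laplacian ::
  "('v::linorder, 'e) hypergraph \<Rightarrow> ('v, 'e) generator tensor \<Rightarrow> ('v, 'e) generator tensor" where
  "laplacian G a = tensor_diff G (tensor_contr G a) + tensor_contr G (tensor_diff G a)"

lemma laplacian_add: "laplacian G (a + b) = laplacian G a + laplacian G b"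
  by (simp add: laplacian_def tensor_diff_add tensor_contr_add)

lemma laplacian_zero [simp]: "laplacian G 0 = 0"
  by (simp add: laplacian_def)

lemma laplacian_scalar: "laplacian G (scalar c * a) = scalar c * laplacian G a"
  by (simp add: laplacian_def tensor_diff_scalar tensor_contr_scalar distrib_left)

lemma laplacian_component:
  assumes "hypergraph G" "a \<in> tensor_component G n"
  shows "laplacian G a \<in> tensor_component G n"
  using tensor_diff_component[OF assms(1) tensor_contr_component[OF assms(2)]]
    tensor_contr_component[OF tensor_diff_component[OF assms]]
  by (simp add: laplacian_def tensor_component_add)

text \<open>A graded commutator of odd derivations is an even derivation, so no sign appears. A
  single letter on the left suits induction over words.\<close>

lemma laplacian_generator_mult:
  "laplacian G (word [g] * a) = laplacian G (word [g]) * a + word [g] * laplacian G a"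
proof -
  let ?s = "koszul_sign (gen_degree G g) :: ('a, 'b) generator tensor"
  have inv: "grade_involution G (word [g]) = ?s * word [g]"
    by (simp add: grade_involution_word word_degree_def)
  \<comment> \<open>The two middle terms cancel against those in \<open>hd\<close>.\<close>
  have dh: "tensor_diff G (tensor_contr G (word [g] * a)) =
    tensor_diff G (gen_contr G g) * a - ?s * gen_contr G g * tensor_diff G a
    + ?s * gen_diff G g * tensor_contr G a + word [g] * tensor_diff G (tensor_contr G a)"
    unfolding tensor_contr_mult tensor_contr_generator inv tensor_diff_add mult.assoc
      tensor_diff_koszul_sign
    unfolding tensor_diff_mult_general grade_involution_gen_contr tensor_diff_generator inv
    by (auto simp: koszul_sign_def algebra_simps)
  have hd: "tensor_contr G (tensor_diff G (word [g] * a)) =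
    tensor_contr G (gen_diff G g) * a - ?s * gen_diff G g * tensor_contr G a
    + ?s * gen_contr G g * tensor_diff G a + word [g] * tensor_contr G (tensor_diff G a)"
    unfolding tensor_diff_mult_general tensor_diff_generator inv tensor_contr_add mult.assoc
      tensor_contr_koszul_sign
    unfolding tensor_contr_mult grade_involution_gen_diff tensor_contr_generator inv
    by (auto simp: koszul_sign_def algebra_simps)
  show ?thesis
    unfolding laplacian_def dh hd tensor_contr_generator tensor_diff_generator
    by (simp add: algebra_simps)
qed

section \<open>Weight and level of words\<close>

text \<open>The diagonal entries of the Laplacian. In the simple case a 1-edge and its vertex are
  exchanged by differential and contraction, so the Laplacian fixes both.\<close>

fun gen_weight :: "('v, 'e) hypergraph \<Rightarrow> ('v, 'e) generator \<Rightarrow> nat" where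
  "gen_weight G (Vertex i) = (if has_loop G i then 1 else 0)"
| "gen_weight G (Edge e) = (if card (ends G e) = 1 then 1 else 0)"

text \<open>
  The off-diagonal part of the Laplacian replaces one edge with at least two ends by words in
  \<open>card (ends G e)\<close> generators of level at most \<open>1\<close>, so \<open>Suc (card (verts G))\<close> makes it lower the level.
\<close>

fun gen_level :: "('v, 'e) hypergraph \<Rightarrow> ('v, 'e) generator \<Rightarrow> nat" where
  "gen_level G (Vertex i) = (if has_loop G i then 1 else 0)"
| "gen_level G (Edge e) = (if card (ends G e) = 1 then 1 else Suc (card (verts G)))"

definition word_weight :: "('v, 'e) hypergraph \<Rightarrow> ('v, 'e) generator list \<Rightarrow> nat" where
  "word_weight G w = (\<Sum>g\<leftarrow>w. gen_weight G g)"

definition word_level :: "('v, 'e) hypergraph \<Rightarrow> ('v, 'e) generator list \<Rightarrow> nat" where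
  "word_level G w = (\<Sum>g\<leftarrow>w. gen_level G g)"

lemma word_level_simps [simp]:
  "word_level G [] = 0" "word_level G (g # w) = gen_level G g + word_level G w"
  "word_level G (u @ v) = word_level G u + word_level G v"
  by (simp_all add: word_level_def)

lemma word_weight_simps [simp]:
  "word_weight G [] = 0" "word_weight G (g # w) = gen_weight G g + word_weight G w"
  by (simp_all add: word_weight_def)

lemma word_degree_simps:
  "word_degree G [] = 0" "word_degree G (g # w) = gen_degree G g + word_degree G w"
  by (simp_all add: word_degree_def)

lemma generator_edge:
  assumes "hypergraph G" "Edge e \<in> generators G"
  shows "card (ends G e) > 0"
  using edges_ends(3)[OF assms(1), of e] assms(2) by (auto simp: generators_def)

lemma word_weight_le_level: "word_weight G w \<le> word_level G w"
proof (induction w)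
  case (Cons g w)
  then show ?case by (cases g) auto
qed simp

text \<open>Letter by letter: vertices and 1-edges have level equal to weight and nonnegative
  degree, while a larger edge has degree at least 1, which pays for its level. So high level in
  fixed degree forces positive weight.\<close>

lemma word_level_le:
  assumes "hypergraph G" "w \<in> lists (generators G)"
  shows "int (word_level G w) \<le> int (word_weight G w) + int (Suc (card (verts G))) * word_degree G w"
  using assms(2)
proof (induction w rule: lists.induct)
  case (Cons g w)
  have "int (gen_level G g) \<le> int (gen_weight G g) + int (Suc (card (verts G))) * gen_degree G g"
  proof (cases g)
    case (Edge e)
    then have "card (ends G e) > 0"
      using generator_edge[OF assms(1)] Cons by blast
    then show ?thesis
      using mult_left_mono[of 1 "int (card (ends G e)) - 1" "int (Suc (card (verts G)))"]
      by (auto simp: Edge)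
  qed auto
  with Cons show ?case
    by (simp add: word_degree_simps distrib_left)
qed (simp add: word_degree_simps)

text \<open>The only generators of degree 0 are the 1-edges, and these have level 1, so every letter
  contributes at least 1.\<close>

lemma length_le_level_degree:
  assumes "hypergraph G" "w \<in> lists (generators G)"
  shows "int (length w) \<le> int (word_level G w) + word_degree G w"
  using assms(2)
proof (induction w rule: lists.induct)
  case (Cons g w)
  have "1 \<le> int (gen_level G g) + gen_degree G g"
  proof (cases g)
    case (Edge e)
    then have "card (ends G e) > 0"
      using generator_edge[OF assms(1)] Cons by blast
    then show ?thesis
      by (auto simp: Edge)
  qed auto
  with Cons show ?case
    by (simp add: word_degree_simps)
qed (simp add: word_degree_simps)

section \<open>The level filtration\<close>

text \<open>The bound is strict, so that \<open>level_below G (word_level G w)\<close> holds the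
  terms of lower order than \<open>w\<close>.\<close>

definition level_below :: "('v, 'e) hypergraph \<Rightarrow> nat \<Rightarrow> ('v, 'e) generator tensor set" where
  "level_below G C = {a. \<forall>w\<in>Poly_Mapping.keys a. word_level G w < C}"

lemma level_below_zero [simp]: "0 \<in> level_below G C"
  by (simp add: level_below_def)

lemma level_below_add:
  "a \<in> level_below G C \<Longrightarrow> b \<in> level_below G C \<Longrightarrow> a + b \<in> level_below G C"
  using keys_add[of a b] by (auto simp: level_below_def)

lemma level_below_mono: "a \<in> level_below G C \<Longrightarrow> C \<le> D \<Longrightarrow> a \<in> level_below G D"
  by (auto simp: level_below_def)

lemma level_below_word: "word w \<in> level_below G C \<longleftrightarrow> word_level G w < C"
  by (simp add: level_below_def word_def)

text \<open>Strictness leaves levels of at most \<open>A - 1\<close> and \<open>B - 1\<close>, whose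
  sum is below \<open>A + B - 1\<close>; hence the \<open>Suc\<close>.\<close>

lemma level_below_mult:
  assumes "a \<in> level_below G A" "b \<in> level_below G B" "A + B \<le> Suc C"
  shows "a * b \<in> level_below G C"
  unfolding level_below_def
proof safe
  fix w assume "w \<in> Poly_Mapping.keys (a * b)"
  then obtain u v where "w = u @ v" "u \<in> Poly_Mapping.keys a" "v \<in> Poly_Mapping.keys b"
    using keys_mult[of a b] unfolding plus_list_def by blast
  with assms show "word_level G w < C"
    by (fastforce simp: level_below_def)
qed

lemma level_below_scalar:
  assumes "a \<in> level_below G C"
  shows "scalar c * a \<in> level_below G C"
proof (rule level_below_mult)
  show "scalar c \<in> level_below G 1"
    by (simp add: level_below_def zero_list_def)
qed (use assms in auto)

lemma level_below_koszul_sign: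
  "a \<in> level_below G C \<Longrightarrow> koszul_sign n * a \<in> level_below G C"
  by (simp add: koszul_sign_def level_below_def)

text \<open>Contraction turns one vertex into a 1-edge, so each resulting word has
  \<open>length vs\<close> letters, all of level at most 1.\<close>

lemma word_contr_vertices_level:
  "word_contr G (map Vertex vs) \<in> level_below G (Suc (length vs))"
proof (induction vs)
  case (Cons i vs)
  have "word_level G (map Vertex vs) \<le> length vs"
    by (induction vs) auto
  moreover have "gen_contr G (Vertex i) \<in> level_below G 2"
    using loop(2)[of G i] by (simp add: level_below_word)
  ultimately have "gen_contr G (Vertex i) * word (map Vertex vs) \<in> level_below G (Suc (Suc (length vs)))"
    by (intro level_below_mult[where B = "Suc (length vs)"]) (auto simp: level_below_word)
  moreover have "word [Vertex i] * word_contr G (map Vertex vs) \<in> level_below G (Suc (Suc (length vs)))"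
    using Cons by (intro level_below_mult[where A = 2]) (auto simp: level_below_word)
  ultimately show ?case
    by (auto simp del: gen_contr.simps simp: mult.assoc intro!: level_below_add level_below_koszul_sign)
qed simp

section \<open>Triangularity of the Laplacian\<close>

text \<open>Vertices and 1-edges leave no remainder. A larger edge has weight 0, and its contracted
  differential has level at most \<open>card (verts G)\<close>, below that of the edge.\<close>

lemma laplacian_generator:
  assumes "hypergraph G" "finite_hypergraph G" "simple_hypergraph G" "g \<in> generators G"
  shows "\<exists>r\<in>level_below G (gen_level G g).
    laplacian G (word [g]) = scalar (gen_weight G g) * word [g] + r"
proof (cases g)
  case (Vertex i)
  then show ?thesis
    using loop(2)[of G i]
    by (intro bexI[of _ 0]) (simp_all add: laplacian_def tensor_contr_generator tensor_diff_generator
        del: word_contr.simps word_diff.simps tensor_contr_word tensor_diff_word)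
next
  case (Edge e)
  then have e: "e \<in> edges G"
    using assms(4) by (auto simp: generators_def)
  \<comment> \<open>The contraction kills edges, so only the contracted differential
    remains.\<close>
  have lap: "laplacian G (word [g]) = word_contr G (map Vertex (sorted_list_of_set (ends G e)))"
    by (simp add: laplacian_def Edge word_Nil)
  show ?thesis
  proof (cases "card (ends G e) = 1")
    case True
    then obtain i where i: "ends G e = {i}"
      by (rule card_1_singletonE)
    \<comment> \<open>By simplicity, contracting the vertex \<open>i\<close> returns this very
      edge.\<close>
    then show ?thesis
      using loop_eq[OF assms(3) e i] unfolding lap
      by (intro bexI[of _ 0]) (simp_all add: Edge word_Nil)
  next
    case False
    have "card (ends G e) \<le> card (verts G)"
      using edges_ends(1)[OF assms(1) e] assms(2) by (simp add: finite_hypergraph_def card_mono)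
    then have "laplacian G (word [g]) \<in> level_below G (gen_level G g)"
      using False level_below_mono[OF word_contr_vertices_level[of G "sorted_list_of_set (ends G e)"],
          of "Suc (card (verts G))"]
      unfolding lap by (simp add: Edge)
    then show ?thesis
      using False by (intro bexI) (auto simp: Edge)
  qed
qed

text \<open>For a derivation the weights of the letters add up, and replacing one letter by terms of
  lower level lowers the total level.\<close>

lemma laplacian_word:
  assumes "hypergraph G" "finite_hypergraph G" "simple_hypergraph G" "w \<in> lists (generators G)"
  shows "\<exists>r\<in>level_below G (word_level G w).
    laplacian G (word w) = scalar (word_weight G w) * word w + r"
  using assms(4)
proof (induction w rule: lists.induct)
  case Nil
  show ?case
    by (intro bexI[of _ 0]) (auto simp: laplacian_def)
next
  case (Cons g w)
  obtain r where r: "r \<in> level_below G (gen_level G g)"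
    "laplacian G (word [g]) = scalar (gen_weight G g) * word [g] + r"
    using laplacian_generator[OF assms(1-3) Cons(1)] by blast
  obtain s where s: "s \<in> level_below G (word_level G w)"
    "laplacian G (word w) = scalar (word_weight G w) * word w + s"
    using Cons by blast
  have "r * word w + word [g] * s \<in> level_below G (word_level G (g # w))"
    using r(1) s(1)
    by (intro level_below_add level_below_mult[where B = "Suc (word_level G w)"]
        level_below_mult[where A = "Suc (gen_level G g)"]) (auto simp: level_below_word)
  moreover have "laplacian G (word (g # w)) =
      scalar (word_weight G (g # w)) * word (g # w) + (r * word w + word [g] * s)"
  proof -
    have "word [g] * (scalar c * word w) = scalar c * (word [g] * word w)" for c
      by (simp add: word_def mult_single plus_list_def zero_list_def)
    then show ?thesis
      unfolding word_Cons[of g w] laplacian_generator_mult r(2) s(2)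
      by (simp add: distrib_left distrib_right single_add mult.assoc del: single_of_nat)
  qed
  ultimately show ?case by blast
qed

lemma tensor_sum_keys:
  fixes a :: "'g tensor"
  shows "a = (\<Sum>w\<in>Poly_Mapping.keys a. scalar (Poly_Mapping.lookup a w) * word w)"
proof -
  have "linear_extension word a = a"
    by (induction a rule: tensor_induct)
      (simp_all add: linear_extension_add linear_extension_monomial)
  then show ?thesis
    by (simp add: linear_extension_def)
qed

lemma laplacian_sum: "laplacian G (sum f A) = (\<Sum>x\<in>A. laplacian G (f x))"
  by (induction A rule: infinite_finite_induct) (simp_all add: laplacian_add)

lemma lookup_scalar_mult:
  "Poly_Mapping.lookup (scalar c * a) w = c * Poly_Mapping.lookup (a :: 'g tensor) w"
  by (induction a rule: tensor_induct)
    (simp_all add: distrib_left lookup_add word_def mult_single lookup_single when_def)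

text \<open>The words of \<open>a\<close> have level at most that of \<open>w\<close>, so their
  remainders lie strictly below it and do not reach the coefficient of \<open>w\<close>.\<close>

lemma lookup_laplacian:
  assumes "hypergraph G" "finite_hypergraph G" "simple_hypergraph G"
    and "a \<in> carrier (tensor_algebra G)" "a \<in> level_below G (Suc (word_level G w))"
  shows "Poly_Mapping.lookup (laplacian G a) w = word_weight G w * Poly_Mapping.lookup a w"
proof -
  have word: "Poly_Mapping.lookup (laplacian G (word u)) w = (if u = w then real (word_weight G w) else 0)"
    if "u \<in> Poly_Mapping.keys a" for u
  proof -
    have u: "u \<in> lists (generators G)" "word_level G u \<le> word_level G w"
      using that assms(4,5) by (auto simp: tensor_carrier_iff level_below_def)
    obtain r where lower: "r \<in> level_below G (word_level G u)"
      and r: "laplacian G (word u) = scalar (word_weight G u) * word u + r"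
      using laplacian_word[OF assms(1-3) u(1)] by blast
    have "w \<notin> Poly_Mapping.keys r"
      using lower u(2) by (auto simp: level_below_def)
    then have "Poly_Mapping.lookup r w = 0"
      by (simp add: in_keys_iff)
    then show ?thesis
      by (simp add: r lookup_add scalar_times_word lookup_single when_def
          del: single_of_nat)
  qed
  have "laplacian G a = (\<Sum>u\<in>Poly_Mapping.keys a. scalar (Poly_Mapping.lookup a u) * laplacian G (word u))"
    by (subst tensor_sum_keys) (simp add: laplacian_sum laplacian_scalar)
  then have "Poly_Mapping.lookup (laplacian G a) w =
      (\<Sum>u\<in>Poly_Mapping.keys a. Poly_Mapping.lookup a u * (if u = w then real (word_weight G w) else 0))"
    by (simp add: lookup_sum lookup_scalar_mult word)
  also have "\<dots> = word_weight G w * Poly_Mapping.lookup a w"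
    by (simp add: if_distrib sum.delta in_keys_iff cong: if_cong)
  finally show ?thesis .
qed

text \<open>A word of level \<open>C\<close> or more does not occur in \<open>a\<close>, so by
  \<open>lookup_laplacian\<close> its coefficient in the image is a multiple of 0.\<close>

lemma laplacian_level:
  assumes "hypergraph G" "finite_hypergraph G" "simple_hypergraph G"
    and "a \<in> carrier (tensor_algebra G)" "a \<in> level_below G C"
  shows "laplacian G a \<in> level_below G C"
  unfolding level_below_def
proof safe
  fix w assume w: "w \<in> Poly_Mapping.keys (laplacian G a)"
  show "word_level G w < C"
  proof (rule ccontr)
    assume "\<not> word_level G w < C"
    then have "a \<in> level_below G (Suc (word_level G w))" "Poly_Mapping.lookup a w = 0"
      using assms(5) by (auto simp: level_below_def in_keys_iff)
    then show False
      using lookup_laplacian[OF assms(1-4), of w] w by (simp add: in_keys_iff)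
  qed
qed


section \<open>Reduction of cocycles to bounded level\<close>

text \<open>Equality of cohomology classes, expressed by representatives in the tensor
  algebra.\<close>

definition cohomologous ::
  "('v::linorder, 'e) hypergraph \<Rightarrow> int \<Rightarrow> ('v, 'e) generator tensor \<Rightarrow> ('v, 'e) generator tensor \<Rightarrow> bool"
  where "cohomologous G n a b \<longleftrightarrow>
    (\<exists>z\<in>tensor_component G (n - 1). a - b - tensor_diff G z \<in> commutator_ideal G)"

lemma cohomologous_refl: "cohomologous G n a a"
  unfolding cohomologous_def by (intro bexI[of _ 0]) (simp_all add: tensor_component_zero)

lemma cohomologous_trans:
  assumes "cohomologous G n a b" "cohomologous G n b c"
  shows "cohomologous G n a c"
proof -
  obtain y z where yz: "y \<in> tensor_component G (n - 1)" "z \<in> tensor_component G (n - 1)"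
    "a - b - tensor_diff G y \<in> commutator_ideal G" "b - c - tensor_diff G z \<in> commutator_ideal G"
    using assms unfolding cohomologous_def by blast
  have "a - c - tensor_diff G (y + z) \<in> commutator_ideal G"
    using commutator_ideal_add[OF yz(3,4)] by (simp add: tensor_diff_add algebra_simps)
  then show ?thesis
    using yz(1,2) unfolding cohomologous_def by (blast intro: tensor_component_add)
qed

text \<open>The differential preserves the ideal and squares to zero, so differentiating the
  relation removes \<open>z\<close>.\<close>

lemma cohomologous_cocycle:
  assumes "hypergraph G" "cohomologous G n a b" "tensor_diff G a \<in> commutator_ideal G"
  shows "tensor_diff G b \<in> commutator_ideal G"
proof -
  obtain z where "a - b - tensor_diff G z \<in> commutator_ideal G"
    using assms(2) unfolding cohomologous_def by blast
  from tensor_diff_commutator_ideal[OF assms(1) this]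
  have "tensor_diff G a - tensor_diff G b \<in> commutator_ideal G"
    by (simp add: tensor_diff_diff tensor_diff_tensor_diff)
  from commutator_ideal_diff[OF assms(3) this] show ?thesis
    by simp
qed

text \<open>For a cocycle, the contraction of \<open>tensor_diff G a\<close> stays in the ideal; the
  rest of the Laplacian is the coboundary of the contraction of \<open>a\<close>.\<close>

lemma cohomologous_laplacian:
  assumes "hypergraph G" "a \<in> tensor_component G n" "tensor_diff G a \<in> commutator_ideal G"
  shows "cohomologous G n a (a - scalar c * laplacian G a)"
proof -
  have "scalar c * tensor_contr G (tensor_diff G a) \<in> commutator_ideal G"
    using assms by (intro commutator_ideal_left tensor_contr_commutator_ideal) auto
  then have "a - (a - scalar c * laplacian G a) - tensor_diff G (scalar c * tensor_contr G a)
      \<in> commutator_ideal G"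
    by (simp add: laplacian_def tensor_diff_scalar distrib_left)
  then show ?thesis
    unfolding cohomologous_def
    using tensor_component_scalar[OF tensor_contr_component[OF assms(2)]] by blast
qed

text \<open>
  The factors \<open>1 - L/j\<close> for \<open>j = 1, \<dots>, k\<close> remove the words of weight \<open>1, \<dots>, k\<close> from the top level.
\<close>

lemma cocycle_raise_weight:
  fixes G :: "('v::linorder, 'e) hypergraph"
  assumes G: "hypergraph G" "finite_hypergraph G" "simple_hypergraph G"
    and a: "a \<in> tensor_component G n" "tensor_diff G a \<in> commutator_ideal G" "a \<in> level_below G (Suc C)"
    and C: "int C > int (Suc (card (verts G))) * n"
  shows "\<exists>b\<in>tensor_component G n. cohomologous G n a b \<and> b \<in> level_below G (Suc C) \<and>
    (\<forall>w\<in>Poly_Mapping.keys b. word_level G w = C \<longrightarrow> word_weight G w > k)"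
proof (induction k)
  case 0
  \<comment> \<open>Above the bound on \<open>C\<close>, \<open>word_level_le\<close> rules out
    weight 0.\<close>
  have "word_weight G w > 0" if "w \<in> Poly_Mapping.keys a" "word_level G w = C" for w
  proof -
    have "w \<in> lists (generators G)" "word_degree G w = n"
      using that(1) a(1) by (auto simp: tensor_component_def tensor_carrier_iff)
    then show ?thesis
      using word_level_le[OF G(1), of w] that(2) C by simp
  qed
  then show ?case
    using a by (intro bexI[of _ a]) (auto simp: cohomologous_refl)
next
  case (Suc k)
  then obtain b where b: "b \<in> tensor_component G n" "cohomologous G n a b" "b \<in> level_below G (Suc C)"
    and weight: "\<And>w. w \<in> Poly_Mapping.keys b \<Longrightarrow> word_level G w = C \<Longrightarrow> word_weight G w > k"
    by blast
  define b' where "b' = b - scalar (1 / real (Suc k)) * laplacian G b"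
  have b'_add: "b' = b + scalar (- (1 / real (Suc k))) * laplacian G b"
    by (simp add: b'_def single_uminus)
  have "b' \<in> tensor_component G n"
    unfolding b'_add using b(1) by (intro tensor_component_add tensor_component_scalar laplacian_component G)
  moreover have "cohomologous G n a b'"
    unfolding b'_def
    using cohomologous_trans[OF b(2)] cohomologous_laplacian[OF G(1) b(1)]
      cohomologous_cocycle[OF G(1) b(2) a(2)] by blast
  moreover have "b' \<in> level_below G (Suc C)"
    unfolding b'_add using b(1,3)
    by (intro level_below_add level_below_scalar laplacian_level G) (auto intro: tensor_component_carrier)
  moreover have "word_weight G w > Suc k" if w: "w \<in> Poly_Mapping.keys b'" "word_level G w = C" for w
  proof -
    \<comment> \<open>On the top level the factor acts diagonally: it kills the words of weight
      \<open>Suc k\<close> and creates no new ones.\<close>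
    have "Poly_Mapping.lookup b' w = (1 - word_weight G w / real (Suc k)) * Poly_Mapping.lookup b w"
      using lookup_laplacian[OF G tensor_component_carrier[OF b(1)], of w] b(3) w(2)
      by (simp add: b'_def lookup_minus lookup_scalar_mult algebra_simps)
    then have "w \<in> Poly_Mapping.keys b" "word_weight G w \<noteq> Suc k"
      using w(1) by (auto simp: in_keys_iff)
    then show ?thesis
      using weight w(2) by (simp add: Suc_lessI)
  qed
  ultimately show ?case by blast
qed

text \<open>Weight never exceeds level, so raising the weight on level \<open>C\<close> above
  \<open>C\<close> empties that level.\<close>

lemma cocycle_lower_level:
  fixes G :: "('v::linorder, 'e) hypergraph"
  assumes G: "hypergraph G" "finite_hypergraph G" "simple_hypergraph G"
    and a: "a \<in> tensor_component G n" "tensor_diff G a \<in> commutator_ideal G" "a \<in> level_below G (Suc C)"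
    and C: "int C > int (Suc (card (verts G))) * n"
  shows "\<exists>b\<in>tensor_component G n. cohomologous G n a b \<and> b \<in> level_below G C"
proof -
  obtain b where b: "b \<in> tensor_component G n" "cohomologous G n a b" "b \<in> level_below G (Suc C)"
    and weight: "\<And>w. w \<in> Poly_Mapping.keys b \<Longrightarrow> word_level G w = C \<Longrightarrow> word_weight G w > C"
    using cocycle_raise_weight[OF assms, of C] by blast
  have "b \<in> level_below G C"
    using b(3) weight leD[OF word_weight_le_level[of G]]
    by (auto simp: level_below_def less_Suc_eq)
  with b show ?thesis by blast
qed

lemma cocycle_bounded_level:
  fixes G :: "('v::linorder, 'e) hypergraph"
  assumes G: "hypergraph G" "finite_hypergraph G" "simple_hypergraph G"
    and a: "a \<in> tensor_component G n" "tensor_diff G a \<in> commutator_ideal G"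
    and D: "int D > int (Suc (card (verts G))) * n"
  shows "\<exists>b\<in>tensor_component G n. cohomologous G n a b \<and> b \<in> level_below G D"
proof -
  \<comment> \<open>Induction on the excess \<open>k\<close> over \<open>D\<close>; the cocycle is
    generalized because every step replaces it.\<close>
  have "\<exists>b\<in>tensor_component G n. cohomologous G n a b \<and> b \<in> level_below G D"
    if "a \<in> tensor_component G n" "tensor_diff G a \<in> commutator_ideal G" "a \<in> level_below G (D + k)" for a k
    using that
  proof (induction k arbitrary: a)
    case 0
    then show ?case by (auto intro: cohomologous_refl)
  next
    case (Suc k)
    have "int (D + k) > int (Suc (card (verts G))) * n"
      using D by simp
    then obtain b where b: "b \<in> tensor_component G n" "cohomologous G n a b" "b \<in> level_below G (D + k)"
      using cocycle_lower_level[OF G Suc.prems(1,2), of "D + k"] Suc.prems(3) by auto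
    then show ?case
      using Suc.IH[OF b(1) cohomologous_cocycle[OF G(1) b(2) Suc.prems(2)] b(3)]
        cohomologous_trans by blast
  qed
  \<comment> \<open>Finite support bounds the level; inserting 0 covers the zero tensor.\<close>
  moreover have "a \<in> level_below G (D + Suc (Max (insert 0 (word_level G ` Poly_Mapping.keys a))))"
    by (auto simp: level_below_def less_Suc_eq_le intro: trans_le_add2)
  ultimately show ?thesis
    using a by blast
qed

text \<open>Fixed degree and bounded level bound the length, over a finite alphabet.\<close>

lemma finite_words_bounded_level:
  assumes "hypergraph G" "finite_hypergraph G" "simple_hypergraph G"
  shows "finite {w \<in> lists (generators G). word_degree G w = n \<and> word_level G w < D}"
proof (rule finite_subset)
  show "{w \<in> lists (generators G). word_degree G w = n \<and> word_level G w < D} \<subseteq>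
      {w. set w \<subseteq> generators G \<and> length w \<le> nat (int D + n)}"
    using length_le_level_degree[OF assms(1)] by (fastforce simp: lists_eq_set)
  show "finite {w. set w \<subseteq> generators G \<and> length w \<le> nat (int D + n)}"
    by (rule finite_lists_length_le[OF finite_generators[OF assms]])
qed


section \<open>Finite dimensionality\<close>

interpretation tensor: vector_space "\<lambda>c a. scalar c * (a :: 'g tensor)"
  by unfold_locales
    (simp_all add: distrib_left distrib_right single_add mult_single single_one flip: mult.assoc)

definition bounded_cocycles ::
  "('v::linorder, 'e) hypergraph \<Rightarrow> int \<Rightarrow> nat \<Rightarrow> ('v, 'e) generator tensor set" where
  "bounded_cocycles G n D =
     {a \<in> tensor_component G n. a \<in> level_below G D \<and> tensor_diff G a \<in> commutator_ideal G}"

text \<open>The words span but need not be cocycles, so they have no classes. A maximal independent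
  set of bounded cocycles does, and it is finite because it lies in the span of finitely many
  words.\<close>

lemma bounded_cocycles_basis:
  assumes "hypergraph G" "finite_hypergraph G" "simple_hypergraph G"
  obtains B where "finite B" "B \<subseteq> bounded_cocycles G n D" "bounded_cocycles G n D \<subseteq> tensor.span B"
proof -
  let ?W = "{w \<in> lists (generators G). word_degree G w = n \<and> word_level G w < D}"
  have span: "bounded_cocycles G n D \<subseteq> tensor.span (word ` ?W)"
  proof
    fix a assume "a \<in> bounded_cocycles G n D"
    then have "Poly_Mapping.keys a \<subseteq> ?W"
      by (auto simp: bounded_cocycles_def tensor_component_def level_below_def tensor_carrier_iff)
    then have "(\<Sum>w\<in>Poly_Mapping.keys a. scalar (Poly_Mapping.lookup a w) * word w) \<in> tensor.span (word ` ?W)"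
      by (intro tensor.span_sum tensor.span_scale tensor.span_base) blast
    then show "a \<in> tensor.span (word ` ?W)"
      using tensor_sum_keys[of a] by simp
  qed
  obtain B where B: "B \<subseteq> bounded_cocycles G n D" "tensor.independent B"
    "bounded_cocycles G n D \<subseteq> tensor.span B"
    using tensor.maximal_independent_subset by blast
  have "finite B"
    using tensor.independent_span_bound[OF finite_imageI[OF finite_words_bounded_level[OF assms]] B(2)]
      B(1) span by blast
  with B show ?thesis using that by blast
qed

lemma cohomology_carrier:
  "carrier (cohomology G n) =
     (\<lambda>X. coboundaries G n +>\<^bsub>MC_algebra G\<lparr>carrier := cocycles G n\<rparr>\<^esub> X) ` cocycles G n"
  by (simp add: cohomology_def quotient_module_simps)

theorem theorem16:
  fixes G :: "('v::linorder, 'e) hypergraph" and i :: int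
  assumes "hypergraph G" and "finite_hypergraph G" and "simple_hypergraph G"
    and "i \<ge> 0"
  shows "vectorspace.fin_dim class_ring (cohomology G i)"
proof -
  interpret H: vectorspace class_ring "cohomology G i"
    by (rule cohomology_vectorspace[OF assms(1)])
  let ?Z = "MC_algebra G\<lparr>carrier := cocycles G i\<rparr>"
  interpret N: abelian_subgroup "coboundaries G i" ?Z
    by (rule submodule_abelian_subgroup[OF coboundaries_submodule[OF assms(1)]])
  \<comment> \<open>Composes both quotient maps, so that the argument can stay with tensors.\<close>
  define cls where "cls a = coboundaries G i +>\<^bsub>?Z\<^esub> MC_class G a" for a
  define cocycle where
    "cocycle a \<longleftrightarrow> a \<in> tensor_component G i \<and> tensor_diff G a \<in> commutator_ideal G" for a
  have cocycle_MC: "MC_class G a \<in> cocycles G i" if "cocycle a" for a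
    using that by (auto simp: cocycle_def cocycles_iff[OF assms(1)])
  have cocycle_zero: "cocycle 0"
    by (simp add: cocycle_def tensor_component_zero)
  have cocycle_add: "cocycle (a + b)" if "cocycle a" "cocycle b" for a b
    using that by (simp add: cocycle_def tensor_component_add tensor_diff_add commutator_ideal_add)
  have cocycle_scalar: "cocycle (scalar c * a)" if "cocycle a" for a c
    using that by (simp add: cocycle_def tensor_component_scalar tensor_diff_scalar commutator_ideal_left)
  have cls_carrier: "cls a \<in> carrier (cohomology G i)" if "cocycle a" for a
    using cocycle_MC[OF that] by (auto simp: cls_def cohomology_carrier)
  have cocycle_carrier: "a \<in> carrier (tensor_algebra G)" if "cocycle a" for a
    using that tensor_component_carrier[of a G i] by (simp add: cocycle_def)
  have cls_add: "cls (a + b) = cls a \<oplus>\<^bsub>cohomology G i\<^esub> cls b" if "cocycle a" "cocycle b" for a b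
  proof -
    have "MC_class G (a + b) = MC_class G a \<oplus>\<^bsub>?Z\<^esub> MC_class G b"
      using MC_class_add[OF that[THEN cocycle_carrier]] by simp
    then show ?thesis
      using N.a_rcos_sum[of "MC_class G a" "MC_class G b"] that[THEN cocycle_MC]
      by (simp add: cls_def cohomology_def quotient_module_simps)
  qed
  have cls_scalar: "cls (scalar c * a) = c \<odot>\<^bsub>cohomology G i\<^esub> cls a" if "cocycle a" for a c
    using quotient_module_smult[OF coboundaries_submodule[OF assms(1)], of c "MC_class G a"]
      cocycle_MC[OF that] MC_class_smult[OF cocycle_carrier[OF that], of c]
    by (simp add: cls_def cohomology_def)
  have cls_zero: "cls 0 = \<zero>\<^bsub>cohomology G i\<^esub>"
    using N.a_rcos_const[OF submoduleD(3)[OF coboundaries_submodule[OF assms(1)]]]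
    by (simp add: cls_def cohomology_def quotient_module_simps MC_class_zero MC_algebra_zero)
  have cls_cohomologous: "cls a = cls b" if ab: "cocycle a" "cocycle b" "cohomologous G i a b" for a b
  proof -
    obtain z where z: "z \<in> tensor_component G (i - 1)" "a - b - tensor_diff G z \<in> commutator_ideal G"
      using ab(3) unfolding cohomologous_def by blast
    have carr: "a \<in> carrier (tensor_algebra G)" "b \<in> carrier (tensor_algebra G)"
      "tensor_diff G z \<in> carrier (tensor_algebra G)"
      using cocycle_carrier ab tensor_diff_carrier[OF assms(1) tensor_component_carrier[OF z(1)]]
      by blast+
    \<comment> \<open>The coboundary comes first, to match the coset form of
      \<open>a_r_coset_iff\<close>.\<close>
    have "MC_class G a = MC_class G (tensor_diff G z + b)"
      using z(2) carr by (subst MC_class_eq_iff) (simp_all add: tensor_carrier_add algebra_simps)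
    also have "\<dots> = MC_class G (tensor_diff G z) \<oplus>\<^bsub>?Z\<^esub> MC_class G b"
      using carr by (simp add: MC_class_add)
    finally have "MC_class G a \<in> coboundaries G i +>\<^bsub>?Z\<^esub> MC_class G b"
      unfolding a_r_coset_iff using coboundaries_iff[OF assms(1)] z(1) by blast
    then show ?thesis
      using N.a_repr_independence' cocycle_MC[OF ab(2)] by (simp add: cls_def)
  qed

  \<comment> \<open>For \<open>i \<ge> 0\<close> this is the least \<open>D\<close> allowed by
    \<open>cocycle_bounded_level\<close>; the outer \<open>Suc\<close> gives strictness.\<close>
  define D where "D = Suc (Suc (card (verts G)) * nat i)"
  obtain B where B: "finite B" "B \<subseteq> bounded_cocycles G i D" "bounded_cocycles G i D \<subseteq> tensor.span B"
    by (rule bounded_cocycles_basis[OF assms(1-3)])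
  have B_cocycle: "cocycle b" if "b \<in> B" for b
    using that B(2) by (auto simp: cocycle_def bounded_cocycles_def)
  then have cls_B: "cls ` B \<subseteq> carrier (cohomology G i)"
    using cls_carrier by blast
  have sub: "submodule class_ring (H.span (cls ` B)) (cohomology G i)"
    using H.span_is_submodule[OF cls_B] .
  \<comment> \<open>The cocycle condition is carried along because linearity of \<open>cls\<close>
    is available on cocycles.\<close>
  have span: "cocycle a \<and> cls a \<in> H.span (cls ` B)" if "a \<in> tensor.span B" for a
    using that
  proof (induction a rule: tensor.span_induct_alt)
    case base
    show ?case
      using cocycle_zero cls_zero submoduleD(3)[OF sub] by simp
  next
    case (step c b y)
    then have "cls b \<in> H.span (cls ` B)"
      using H.in_own_span[OF cls_B] by blast
    with step show ?case
      using B_cocycle[OF step(1)] cocycle_scalar[of b c]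
      by (auto simp: cocycle_add cls_add cls_scalar intro!: submoduleD(4,5)[OF sub])
  qed
  have "carrier (cohomology G i) \<subseteq> H.span (cls ` B)"
  proof
    fix x assume "x \<in> carrier (cohomology G i)"
    then obtain a where a: "cocycle a" "x = cls a"
      unfolding cohomology_carrier by (auto simp: cocycles_iff[OF assms(1)] cocycle_def cls_def)
    have "int D > int (Suc (card (verts G))) * i"
      using assms(4) by (simp add: D_def algebra_simps)
    then obtain b where b: "b \<in> tensor_component G i" "cohomologous G i a b" "b \<in> level_below G D"
      using cocycle_bounded_level[OF assms(1-3), of a i D] a(1) by (auto simp: cocycle_def)
    then have "b \<in> bounded_cocycles G i D" "cocycle b"
      using cohomologous_cocycle[OF assms(1) b(2)] a(1) by (auto simp: bounded_cocycles_def cocycle_def)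
    then show "x \<in> H.span (cls ` B)"
      using span B(3) cls_cohomologous[OF a(1) _ b(2)] a(2) by auto
  qed
  then have "H.span (cls ` B) = carrier (cohomology G i)"
    using submoduleD(2)[OF sub] by blast
  then show ?thesis
    unfolding H.fin_dim_def using B(1) cls_B by blast
qed

end
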